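(* Fix a constant number $m$ of candidates and an (anonymous) voting protocol. Consider any one of the coalitional manipulation problems listed in the context, and suppose that evaluating the result of a particular combination of votes by the coalition (that is, deciding, for a given problem instance and given votes for all coalition members, whether these votes achieve the coalition's goal) can be done in polynomial time. If instances are restricted to those in which there is only one voter in the coalition, or to those in which the voters are unweighted, then the manipulation problem is in $\mathcal{P}$.
   Context: An election consists of a set of $m$ candidates, a set of $n$ voters each of whom provides a total order on the candidates (a vote), and a winner determination function from combinations of votes to candidates, which is specified by the voting protocol. Voters may have integer weights $\ge 0$, written in binary; a vote of weight $k$ is interpreted as $k$ identical unweighted votes. Voters are unweighted if all of them have weight 1. Voters of equal weight are interchangeable (anonymity): only the multiplicities of the votes cast by equally weighted coalition members matter for the result. In a manipulation problem, a coalition of voters (the manipulators) must choose its votes. The variants are as follows. - Constructive: given the votes of the non-members, can the coalition cast its votes so that a given candidate $p$ wins? - Destructive: given the votes of the non-members, can the coalition cast its votes so that a given candidate $h$ does not win? - Uncertain variants: given in addition a number $r\in[0,1]$, and either a distribution over instantiations of the voting protocol or a distribution over the non-members' votes, can the coalition cast its votes so that $p$ wins (respectively, $h$ does not win) with probability greater than $r$? In every variant the coalition members are listed explicitly in the input, so the input size is at least the number of coalition members. *)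

theory Defs
  imports
    "HOL-Probability.Probability"
    "HOL-Combinatorics.Multiset_Permutations"
    "HOL-Computational_Algebra.Polynomial"
begin

section \<open>Deterministic polynomial time\<close>

text \<open>
  Words are over a five-letter input alphabet: two digits, a terminator for digit strings, and a
  pair of brackets.
\<close>

datatype letter = Zero | One | End | Open | Close

text \<open>
  Deterministic multitape Turing machines with two-way infinite tapes. States and tape symbols are
  natural numbers, taken from finite sets belonging to the machine; symbol 0 is the blank. The
  transition function maps a state and the symbols under the heads to a new state and, for every
  tape, a symbol to write and a head displacement.
\<close>

record tm =
  tape_count :: nat
  states :: "nat set"
  symbols :: "nat set"
  start :: nat
  accept :: nat
  reject :: nat
  trans :: "nat \<Rightarrow> nat list \<Rightarrow> nat \<times> (nat \<times> int) list"

fun letter_symbol :: "letter \<Rightarrow> nat" where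
  "letter_symbol Zero = 1"
| "letter_symbol One = 2"
| "letter_symbol End = 3"
| "letter_symbol Open = 4"
| "letter_symbol Close = 5"

definition turing_machine :: "tm \<Rightarrow> bool" where
  "turing_machine M \<longleftrightarrow>
     tape_count M \<ge> 1 \<and>
     finite (states M) \<and> {start M, accept M, reject M} \<subseteq> states M \<and> accept M \<noteq> reject M \<and>
     finite (symbols M) \<and> insert 0 (range letter_symbol) \<subseteq> symbols M \<and>
     (\<forall>q \<in> states M. \<forall>ss. length ss = tape_count M \<and> set ss \<subseteq> symbols M \<longrightarrow>
        (case trans M q ss of (q', as) \<Rightarrow>
           q' \<in> states M \<and> length as = tape_count M \<and> set as \<subseteq> symbols M \<times> {-1, 0, 1}))"

text \<open>A tape consists of its contents and the position of the head.\<close>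

type_synonym tape = "(int \<Rightarrow> nat) \<times> int"

type_synonym config = "nat \<times> tape list"

definition read_tape :: "tape \<Rightarrow> nat" where
  "read_tape t = fst t (snd t)"

definition act_tape :: "tape \<Rightarrow> nat \<times> int \<Rightarrow> tape" where
  "act_tape t a = ((fst t)(snd t := fst a), snd t + snd a)"

definition step :: "tm \<Rightarrow> config \<Rightarrow> config" where
  "step M c =
     (if fst c \<in> {accept M, reject M} then c
      else case trans M (fst c) (map read_tape (snd c)) of (q, as) \<Rightarrow> (q, map2 act_tape (snd c) as))"

definition blank_tape :: tape where
  "blank_tape = ((\<lambda>_. 0), 0)"

definition word_tape :: "letter list \<Rightarrow> tape" where
  "word_tape w =
     ((\<lambda>i. if 0 \<le> i \<and> i < int (length w) then letter_symbol (w ! nat i) else 0), 0)"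

definition initial :: "tm \<Rightarrow> letter list \<Rightarrow> config" where
  "initial M w = (start M, word_tape w # replicate (tape_count M - 1) blank_tape)"

definition decides_in_time :: "tm \<Rightarrow> letter list set \<Rightarrow> (nat \<Rightarrow> nat) \<Rightarrow> bool" where
  "decides_in_time M A T \<longleftrightarrow>
     (\<forall>w. \<exists>t \<le> T (length w).
        fst ((step M ^^ t) (initial M w)) = (if w \<in> A then accept M else reject M))"

definition PTIME :: "letter list set set" where
  "PTIME = {A. \<exists>M (p :: nat poly). turing_machine M \<and> decides_in_time M A (poly p)}"


section \<open>Encodings\<close>

datatype code = Bits "bool list" | Group "code list"

fun serialize :: "code \<Rightarrow> letter list" where
  "serialize (Bits bs) = map (\<lambda>b. if b then One else Zero) bs @ [End]"
| "serialize (Group cs) = Open # concat (map serialize cs) @ [Close]"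

text \<open>Binary digits, most significant first, without leading zeros; 0 has no digits.\<close>

fun binary :: "nat \<Rightarrow> bool list" where
  "binary n = (if n = 0 then [] else binary (n div 2) @ [odd n])"

declare binary.simps [simp del]

definition nat_code :: "nat \<Rightarrow> code" where
  "nat_code n = Bits (binary n)"

text \<open>Only used for nonnegative numbers.\<close>

definition rat_code :: "rat \<Rightarrow> code" where
  "rat_code r = (case quotient_of r of (a, b) \<Rightarrow> Group [nat_code (nat a), nat_code (nat b)])"


section \<open>Elections\<close>

text \<open>
  The candidates are the numbers below \<open>m\<close>. A vote, i.e. a total order on the candidates, is given
  as the list of all candidates from most to least preferred.
\<close>

type_synonym vote = "nat list"

definition votes :: "nat \<Rightarrow> vote set" where
  "votes m = permutations_of_set {..<m}"

definition profiles :: "nat \<Rightarrow> nat \<Rightarrow> vote list set" where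
  "profiles m n = {V. length V = n \<and> set V \<subseteq> votes m}"

text \<open>A protocol maps unweighted votes, from any number of voters, to the winner.\<close>

type_synonym protocol = "vote list \<Rightarrow> nat"

definition anonymous_protocol :: "nat \<Rightarrow> protocol \<Rightarrow> bool" where
  "anonymous_protocol m f \<longleftrightarrow>
     (\<forall>V. set V \<subseteq> votes m \<longrightarrow> f V < m \<and> (\<forall>W. mset W = mset V \<longrightarrow> f W = f V))"

text \<open>A vote of weight \<open>k\<close> stands for \<open>k\<close> unweighted votes.\<close>

definition unweight :: "nat list \<Rightarrow> vote list \<Rightarrow> vote list" where
  "unweight ws V = concat (map2 replicate ws V)"


section \<open>Manipulation problems\<close>

datatype goal = Constructive | Destructive

fun goal_met :: "goal \<Rightarrow> nat \<Rightarrow> nat \<Rightarrow> bool" where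
  "goal_met Constructive c winner \<longleftrightarrow> winner = c"
| "goal_met Destructive c winner \<longleftrightarrow> winner \<noteq> c"

text \<open>
  The fixed (non-input) part of a problem. In the uncertain variants, instances describe
  distributions by bit strings, and an arbitrary partial function says which distribution a
  bit string denotes. This covers explicit tables of probabilities as well as succinct
  descriptions such as independently drawn votes. The type \<open>'i\<close> is that of the
  instantiations of the protocol.
\<close>

datatype 'i setting =
  Certain protocol
| Uncertain_Protocol "'i \<Rightarrow> protocol" "bool list \<Rightarrow> 'i pmf option"
| Uncertain_Votes protocol "bool list \<Rightarrow> vote list pmf option"

fun anonymous_setting :: "nat \<Rightarrow> 'i setting \<Rightarrow> bool" where
  "anonymous_setting m (Certain f) \<longleftrightarrow> anonymous_protocol m f"
| "anonymous_setting m (Uncertain_Protocol F D) \<longleftrightarrow> (\<forall>i. anonymous_protocol m (F i))"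
| "anonymous_setting m (Uncertain_Votes f D) \<longleftrightarrow> anonymous_protocol m f"

text \<open>
  What an instance says about the election besides weights and candidate: the votes of the
  non-members, or these together with (the description of) a distribution over instantiations
  and the threshold \<open>r\<close>, or a distribution over the votes of the non-members and \<open>r\<close>.
\<close>

datatype information =
  Votes_Info "vote list"
| Protocol_Dist_Info "vote list" "bool list" rat
| Votes_Dist_Info "bool list" rat

record manip_instance =
  coalition_weights :: "nat list"
  other_weights :: "nat list"
  target :: nat
  info :: information

text \<open>The parameter \<open>n\<close> is the number of non-members.\<close>

fun valid_info :: "nat \<Rightarrow> nat \<Rightarrow> 'i setting \<Rightarrow> information \<Rightarrow> bool" where
  "valid_info m n (Certain f) (Votes_Info V) \<longleftrightarrow> V \<in> profiles m n"
| "valid_info m n (Uncertain_Protocol F D) (Protocol_Dist_Info V d r) \<longleftrightarrow>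
     V \<in> profiles m n \<and> D d \<noteq> None \<and> 0 \<le> r \<and> r \<le> 1"
| "valid_info m n (Uncertain_Votes f D) (Votes_Dist_Info d r) \<longleftrightarrow>
     (\<exists>\<mu>. D d = Some \<mu> \<and> set_pmf \<mu> \<subseteq> profiles m n) \<and> 0 \<le> r \<and> r \<le> 1"
| "valid_info m n _ _ \<longleftrightarrow> False"

definition valid_instance :: "nat \<Rightarrow> 'i setting \<Rightarrow> manip_instance \<Rightarrow> bool" where
  "valid_instance m S x \<longleftrightarrow>
     target x < m \<and> valid_info m (length (other_weights x)) S (info x)"

definition winner :: "protocol \<Rightarrow> manip_instance \<Rightarrow> vote list \<Rightarrow> vote list \<Rightarrow> nat" where
  "winner f x V C = f (unweight (other_weights x) V @ unweight (coalition_weights x) C)"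

text \<open>
  Whether the votes \<open>C\<close> of the coalition achieve its goal, by the kind of setting and of
  information; the last equation is for combinations excluded by \<^const>\<open>valid_info\<close>.
\<close>

fun achieves_with ::
    "'i setting \<Rightarrow> goal \<Rightarrow> manip_instance \<Rightarrow> information \<Rightarrow> vote list \<Rightarrow> bool" where
  "achieves_with (Certain f) g x (Votes_Info V) C \<longleftrightarrow>
     goal_met g (target x) (winner f x V C)"
| "achieves_with (Uncertain_Protocol F D) g x (Protocol_Dist_Info V d r) C \<longleftrightarrow>
     measure_pmf.prob (the (D d)) {i. goal_met g (target x) (winner (F i) x V C)} > real_of_rat r"
| "achieves_with (Uncertain_Votes f D) g x (Votes_Dist_Info d r) C \<longleftrightarrow>
     measure_pmf.prob (the (D d)) {V. goal_met g (target x) (winner f x V C)} > real_of_rat r"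
| "achieves_with _ g x _ C \<longleftrightarrow> False"

definition achieves :: "'i setting \<Rightarrow> goal \<Rightarrow> manip_instance \<Rightarrow> vote list \<Rightarrow> bool" where
  "achieves S g x C \<longleftrightarrow> achieves_with S g x (info x) C"

definition coalition_profiles :: "nat \<Rightarrow> manip_instance \<Rightarrow> vote list set" where
  "coalition_profiles m x = profiles m (length (coalition_weights x))"

definition single_manipulator :: "manip_instance \<Rightarrow> bool" where
  "single_manipulator x \<longleftrightarrow> length (coalition_weights x) = 1"

definition unweighted :: "manip_instance \<Rightarrow> bool" where
  "unweighted x \<longleftrightarrow> (\<forall>w \<in> set (coalition_weights x) \<union> set (other_weights x). w = 1)"


section \<open>The problems as languages\<close>

definition votes_code :: "vote list \<Rightarrow> code" where
  "votes_code V = Group (map (\<lambda>v. Group (map nat_code v)) V)"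

fun info_code :: "information \<Rightarrow> code" where
  "info_code (Votes_Info V) = Group [votes_code V]"
| "info_code (Protocol_Dist_Info V d r) = Group [votes_code V, Bits d, rat_code r]"
| "info_code (Votes_Dist_Info d r) = Group [Bits d, rat_code r]"

definition instance_code :: "manip_instance \<Rightarrow> code" where
  "instance_code x =
     Group [Group (map nat_code (coalition_weights x)), Group (map nat_code (other_weights x)),
            nat_code (target x), info_code (info x)]"

definition evaluation_problem :: "nat \<Rightarrow> 'i setting \<Rightarrow> goal \<Rightarrow> letter list set" where
  "evaluation_problem m S g =
     {serialize (Group [instance_code x, votes_code C]) | x C.
        valid_instance m S x \<and> C \<in> coalition_profiles m x \<and> achieves S g x C}"

text \<open>The manipulation problem for the instances satisfying the restriction \<open>R\<close>.\<close>

definition manipulation_problem ::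
    "nat \<Rightarrow> 'i setting \<Rightarrow> goal \<Rightarrow> (manip_instance \<Rightarrow> bool) \<Rightarrow> letter list set" where
  "manipulation_problem m S g R =
     {serialize (instance_code x) | x.
        valid_instance m S x \<and> R x \<and> (\<exists>C \<in> coalition_profiles m x. achieves S g x C)}"

end

theory Submission
  imports Defs
begin

text \<open>
  By anonymity only the multiplicities of the at most \<open>m!\<close> possible votes within the coalition
  matter; there are polynomially many combinations of multiplicities, and each is tested with the
  machine for the evaluation problem. With a single manipulator the order of the coalition's votes
  is trivial, and with unit weights the pairing of votes and weights is.

  No validity check of the input \<open>w\<close> is needed. The evaluation machine is run on
  \<open>w\<close> followed by an encoded coalition vote, the whole in brackets; matching brackets from
  the right shows that it can accept only if \<open>w\<close> encodes a valid instance. Likewise votes of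
  the wrong number are rejected, so that every multiplicity may range over all numbers below the
  length of \<open>w\<close>. The two restrictions on instances are regular conditions on their encodings.

  The machine is written as a structured program over tapes. A program is compiled by taking as
  states the continuation stacks that can occur, of which there are finitely many.
\<close>

section \<open>Tape programs\<close>

text \<open>The delicate point is to reuse one unknown machine polynomially often. Its time bound
  need not be computed, since the machine halts by itself; the polynomial occurs only in the
  analysis. But a run leaves heads displaced and cells written at places that depend on the run, and
  the next run needs blank tapes. Hence the head-relative description, and a counter of how far a
  run may have strayed, which then drives the erasing. The search never stops early: success is
  collected in a flag. Each loop thus restores every tape but the flag, and one induction covers the
  nesting, with a time bound that does not depend on the outcomes. As m is fixed, so is the nesting
  depth, and the degree of the bound with it. Malformed words are harmless because the given machine
  decides its language on all words, also on those that encode nothing. For the same reason the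
  automata have to be correct only on genuine encodings.\<close>

text \<open>
  A tape is described relative to its head: the given machine can then be restarted wherever its
  heads were left.
\<close>

type_synonym view = "int \<Rightarrow> nat"

definition view :: "tape \<Rightarrow> view" where
  "view t = (\<lambda>d. fst t (snd t + d))"

definition act_view :: "view \<Rightarrow> nat \<times> int \<Rightarrow> view" where
  "act_view v a = (\<lambda>d. (v(0 := fst a)) (d + snd a))"

lemma view_act_tape: "view (act_tape t a) = act_view (view t) a"
  by (auto simp: view_def act_view_def act_tape_def fun_eq_iff algebra_simps)

lemma read_tape_view: "read_tape t = view t 0"
  by (simp add: view_def read_tape_def)

definition shifted :: "view \<Rightarrow> int \<Rightarrow> view" where
  "shifted v s = (\<lambda>d. v (d + s))"

lemma act_view_same [simp]: "v 0 = s \<Longrightarrow> act_view v (s, d) = shifted v d"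
  by (auto simp: act_view_def shifted_def)

lemma shifted_shifted [simp]: "shifted (shifted v a) b = shifted v (a + b)"
  by (auto simp: shifted_def algebra_simps)

lemma shifted_0 [simp]: "shifted v 0 = v"
  by (simp add: shifted_def)

lemma shifted_apply [simp]: "shifted v s 0 = v s"
  by (simp add: shifted_def)

abbreviation blank :: view where
  "blank \<equiv> (\<lambda>_. 0)"

section \<open>Syntax and small-step semantics of tape programs\<close>

datatype prog =
  Act "(nat \<Rightarrow> nat) \<Rightarrow> nat \<Rightarrow> nat \<times> int"
| Seq prog prog
| While "(nat \<Rightarrow> nat) \<Rightarrow> bool" prog

fun next_stack :: "prog list \<Rightarrow> (nat \<Rightarrow> nat) \<Rightarrow> prog list" where
  "next_stack [] r = []"
| "next_stack (Act f # s) r = s"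
| "next_stack (Seq p q # s) r = p # q # s"
| "next_stack (While c p # s) r = (if c r then p # While c p # s else s)"

fun actions :: "prog list \<Rightarrow> (nat \<Rightarrow> nat) \<Rightarrow> nat \<Rightarrow> nat \<times> int" where
  "actions (Act f # s) r = f r"
| "actions s r = (\<lambda>i. (r i, 0))"

definition reads :: "(nat \<Rightarrow> view) \<Rightarrow> nat \<Rightarrow> nat" where
  "reads ts i = ts i 0"

definition perform :: "(nat \<Rightarrow> view) \<Rightarrow> (nat \<Rightarrow> nat \<times> int) \<Rightarrow> nat \<Rightarrow> view" where
  "perform ts a = (\<lambda>i. act_view (ts i) (a i))"

fun prog_step :: "prog list \<times> (nat \<Rightarrow> view) \<Rightarrow> prog list \<times> (nat \<Rightarrow> view)" where
  "prog_step (s, ts) = (next_stack s (reads ts), perform ts (actions s (reads ts)))"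

lemma perform_idle: "perform ts (\<lambda>i. (reads ts i, 0)) = ts"
  by (simp add: perform_def reads_def)

text \<open>The continuation \<open>s\<close> is arbitrary, which makes the relation compose under
  \<open>Seq\<close> and \<open>While\<close>. Time is bounded only from above, so that passes of
  different duration can share one bound.\<close>

definition runs :: "prog \<Rightarrow> (nat \<Rightarrow> view) \<Rightarrow> nat \<Rightarrow> (nat \<Rightarrow> view) \<Rightarrow> bool" where
  "runs p ts n ts' \<longleftrightarrow> (\<forall>s. \<exists>t \<le> n. (prog_step ^^ t) (p # s, ts) = (s, ts'))"

lemma runs_mono: "runs p ts n ts' \<Longrightarrow> n \<le> n' \<Longrightarrow> runs p ts n' ts'"
  unfolding runs_def by (meson le_trans)

lemma runs_Act: "perform ts (f (reads ts)) = ts' \<Longrightarrow> runs (Act f) ts 1 ts'"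
  unfolding runs_def by (auto intro!: exI[of _ 1])

lemma runs_Seq:
  assumes "runs p ts a ts1" "runs q ts1 b ts2"
  shows "runs (Seq p q) ts (Suc (a + b)) ts2"
  unfolding runs_def
proof
  fix s
  obtain t1 where t1: "t1 \<le> a" "(prog_step ^^ t1) (p # q # s, ts) = (q # s, ts1)"
    using assms(1) unfolding runs_def by blast
  obtain t2 where t2: "t2 \<le> b" "(prog_step ^^ t2) (q # s, ts1) = (s, ts2)"
    using assms(2) unfolding runs_def by blast
  have "(prog_step ^^ (t2 + t1)) (p # q # s, ts) = (s, ts2)"
    using t1 t2 by (simp add: funpow_add)
  then have "(prog_step ^^ Suc (t2 + t1)) (Seq p q # s, ts) = (s, ts2)"
    by (simp add: funpow_Suc_right perform_idle del: funpow.simps(2))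
  then show "\<exists>t\<le>Suc (a + b). (prog_step ^^ t) (Seq p q # s, ts) = (s, ts2)"
    using t1 t2 by (intro exI[of _ "Suc (t2 + t1)"]) auto
qed

lemma runs_While_False: "\<not> c (reads ts) \<Longrightarrow> runs (While c p) ts 1 ts"
  unfolding runs_def by (auto intro!: exI[of _ 1] simp: perform_idle)

lemma runs_While_True:
  assumes "c (reads ts)" "runs p ts a ts1" "runs (While c p) ts1 b ts2"
  shows "runs (While c p) ts (Suc (a + b)) ts2"
  unfolding runs_def
proof
  fix s
  obtain t1 where t1: "t1 \<le> a" "(prog_step ^^ t1) (p # While c p # s, ts) = (While c p # s, ts1)"
    using assms(2) unfolding runs_def by blast
  obtain t2 where t2: "t2 \<le> b" "(prog_step ^^ t2) (While c p # s, ts1) = (s, ts2)"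
    using assms(3) unfolding runs_def by blast
  have "(prog_step ^^ (t2 + t1)) (p # While c p # s, ts) = (s, ts2)"
    using t1 t2 by (simp add: funpow_add)
  then have "(prog_step ^^ Suc (t2 + t1)) (While c p # s, ts) = (s, ts2)" using assms(1)
    by (simp add: funpow_Suc_right perform_idle del: funpow.simps(2))
  then show "\<exists>t\<le>Suc (a + b). (prog_step ^^ t) (While c p # s, ts) = (s, ts2)"
    using t1 t2 by (intro exI[of _ "Suc (t2 + t1)"]) auto
qed

lemma runs_While:
  assumes "\<And>j. j < n \<Longrightarrow> c (reads (\<sigma> j))"
    and "\<And>j. j < n \<Longrightarrow> runs p (\<sigma> j) a (\<sigma> (Suc j))"
    and "\<not> c (reads (\<sigma> n))"
  shows "runs (While c p) (\<sigma> 0) (n * Suc a + 1) (\<sigma> n)"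
proof -
  \<comment> \<open>\<open>j\<close> counts the passes still to come, because
    \<open>runs_While_True\<close> peels off the first pass.\<close>
  have "runs (While c p) (\<sigma> (n - j)) (j * Suc a + 1) (\<sigma> n)" if "j \<le> n" for j
    using that
  proof (induction j)
    case 0
    then show ?case using runs_While_False[of c "\<sigma> n", OF assms(3)] by simp
  next
    case (Suc j)
    then have s: "Suc (n - Suc j) = n - j" by simp
    have "runs (While c p) (\<sigma> (n - Suc j)) (Suc (a + (j * Suc a + 1))) (\<sigma> n)"
      using Suc assms(1)[of "n - Suc j"] assms(2)[of "n - Suc j"]
      by (intro runs_While_True) (auto simp: s)
    then show ?case by (rule runs_mono) simp
  qed
  from this[of n] show ?thesis by simp
qed

section \<open>Compilation of tape programs\<close>

text \<open>A loop body always runs with its own loop directly beneath it, so repeated unrolling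
  produces nothing new and the set stays finite. The empty stack is kept out: appending a
  continuation commutes with \<open>next_stack\<close> only for nonempty stacks.\<close>

fun stacks :: "prog \<Rightarrow> prog list set" where
  "stacks (Act f) = {[Act f]}"
| "stacks (Seq p q) = insert [Seq p q] ((\<lambda>s. s @ [q]) ` stacks p \<union> stacks q)"
| "stacks (While c p) = insert [While c p] ((\<lambda>s. s @ [While c p]) ` stacks p)"

lemma finite_stacks: "finite (stacks p)"
  by (induction p) auto

lemma start_in_stacks: "[p] \<in> stacks p"
  by (cases p) auto

lemma next_stack_append: "s \<noteq> [] \<Longrightarrow> next_stack (s @ s') r = next_stack s r @ s'"
  by (cases "(s, r)" rule: next_stack.cases) auto

lemma Nil_notin_stacks: "[] \<notin> stacks p"
  by (induction p) auto

lemma next_stack_in_stacks: "s \<in> stacks p \<Longrightarrow> next_stack s r \<in> insert [] (stacks p)"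
proof (induction p arbitrary: s)
  case (Seq p q)
  from Seq.prems consider "s = [Seq p q]" | s1 where "s = s1 @ [q]" "s1 \<in> stacks p" | "s \<in> stacks q"
    by auto
  then show ?case
  proof cases
    case 1
    have "[p] @ [q] \<in> stacks (Seq p q)" using start_in_stacks[of p] by (simp add: image_iff)
    then show ?thesis using 1 by simp
  next
    case 2
    have "s1 \<noteq> []" using 2(2) Nil_notin_stacks by auto
    moreover have "next_stack s1 r @ [q] \<in> stacks (Seq p q)"
      using Seq.IH(1)[OF 2(2)] start_in_stacks[of q] by auto
    ultimately show ?thesis using 2 by (simp add: next_stack_append)
  next
    case 3
    then show ?thesis using Seq.IH(2) by auto
  qed
next
  case (While c p)
  from While.prems consider "s = [While c p]" | s1 where "s = s1 @ [While c p]" "s1 \<in> stacks p"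
    by auto
  then show ?case
  proof cases
    case 1
    have "[p] @ [While c p] \<in> stacks (While c p)" using start_in_stacks[of p] by (simp add: image_iff)
    then show ?thesis using 1 by simp
  next
    case 2
    have "s1 \<noteq> []" using 2(2) Nil_notin_stacks by auto
    moreover have "next_stack s1 r @ [While c p] \<in> stacks (While c p)"
      using While.IH[OF 2(2)] by auto
    ultimately show ?thesis using 2 by (simp add: next_stack_append)
  qed
qed auto

text \<open>Tapes from number \<open>K\<close> on do not exist in the machine; they are blank and must stay so.\<close>

definition safe_act :: "nat \<Rightarrow> nat set \<Rightarrow> ((nat \<Rightarrow> nat) \<Rightarrow> nat \<Rightarrow> nat \<times> int) \<Rightarrow> bool" where
  "safe_act K \<Gamma> f \<longleftrightarrow> (\<forall>r. (\<forall>i\<ge>K. r i = 0) \<longrightarrow>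
     (\<forall>i\<ge>K. f r i = (0, 0)) \<and> ((\<forall>i. r i \<in> \<Gamma>) \<longrightarrow> (\<forall>i<K. f r i \<in> \<Gamma> \<times> {-1, 0, 1})))"

fun safe :: "nat \<Rightarrow> nat set \<Rightarrow> prog \<Rightarrow> bool" where
  "safe K \<Gamma> (Act f) \<longleftrightarrow> safe_act K \<Gamma> f"
| "safe K \<Gamma> (Seq p q) \<longleftrightarrow> safe K \<Gamma> p \<and> safe K \<Gamma> q"
| "safe K \<Gamma> (While c p) \<longleftrightarrow> safe K \<Gamma> p"

lemma safe_stacks: "s \<in> stacks p \<Longrightarrow> safe K \<Gamma> p \<Longrightarrow> q \<in> set s \<Longrightarrow> safe K \<Gamma> q"
  by (induction p arbitrary: s) auto

lemma safe_actions:
  assumes "s \<in> stacks p" "safe K \<Gamma> p"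
  shows "safe_act K \<Gamma> (actions s)"
proof (cases s)
  case (Cons q s')
  then have "safe K \<Gamma> q" using safe_stacks[OF assms] by simp
  then show ?thesis using Cons by (cases q) (auto simp: safe_act_def)
qed (auto simp: safe_act_def)

definition stack_number :: "prog \<Rightarrow> prog list \<Rightarrow> nat" where
  "stack_number p = (SOME e. inj_on e (insert [] (stacks p)))"

definition numbered_stack :: "prog \<Rightarrow> nat \<Rightarrow> prog list" where
  "numbered_stack p = inv_into (insert [] (stacks p)) (stack_number p)"

lemma numbered_stack_number [simp]:
  assumes "s \<in> insert [] (stacks p)"
  shows "numbered_stack p (stack_number p s) = s"
proof -
  have "\<exists>e::prog list \<Rightarrow> nat. inj_on e (insert [] (stacks p))"
    using finite_imp_inj_to_nat_seg[of "insert [] (stacks p)"] finite_stacks by auto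
  then have "inj_on (stack_number p) (insert [] (stacks p))"
    unfolding stack_number_def by (rule someI_ex)
  then show ?thesis unfolding numbered_stack_def using assms by (rule inv_into_f_f)
qed

definition padded :: "nat \<Rightarrow> nat list \<Rightarrow> nat \<Rightarrow> nat" where
  "padded K ss = (\<lambda>i. if i < K then ss ! i else 0)"

text \<open>States are naturals, so stacks enter through an injective numbering, moved up by 2 to
  leave 0 and 1 for the two verdicts. From the empty stack one extra step evaluates
  \<open>acc\<close>.\<close>

definition compile :: "nat \<Rightarrow> nat set \<Rightarrow> prog \<Rightarrow> ((nat \<Rightarrow> nat) \<Rightarrow> bool) \<Rightarrow> tm" where
  "compile K \<Gamma> p acc =
     \<lparr>tape_count = K,
      states = {0, 1} \<union> (\<lambda>s. stack_number p s + 2) ` insert [] (stacks p),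
      symbols = \<Gamma>, start = stack_number p [p] + 2, accept = 0, reject = 1,
      trans = (\<lambda>q ss. let r = padded K ss; s = numbered_stack p (q - 2) in
        if q < 2 then (q, map (\<lambda>i. (r i, 0)) [0..<K])
        else (if s = [] then (if acc r then 0 else 1) else stack_number p (next_stack s r) + 2,
              map (actions s r) [0..<K]))\<rparr>"

lemma turing_machine_compile:
  assumes "safe K \<Gamma> p" "finite \<Gamma>" "K \<ge> 1" "insert 0 (range letter_symbol) \<subseteq> \<Gamma>"
  shows "turing_machine (compile K \<Gamma> p acc)"
proof -
  have "case trans (compile K \<Gamma> p acc) q ss of (q', as) \<Rightarrow>
      q' \<in> states (compile K \<Gamma> p acc) \<and> length as = K \<and> set as \<subseteq> \<Gamma> \<times> {-1, 0, 1}"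
    if q: "q \<in> states (compile K \<Gamma> p acc)" and ss: "length ss = K" "set ss \<subseteq> \<Gamma>" for q ss
  proof -
    define r where "r = padded K ss"
    have r: "\<forall>i. r i \<in> \<Gamma>" "\<forall>i\<ge>K. r i = 0"
      using ss assms(4) by (auto simp: r_def padded_def set_conv_nth subset_iff)
    have idle: "set (map (\<lambda>i. (r i, 0)) [0..<K]) \<subseteq> \<Gamma> \<times> {-1, 0, 1::int}"
      using r by auto
    show ?thesis
    proof (cases "q < 2")
      case True
      then show ?thesis using idle by (auto simp: compile_def r_def Let_def)
    next
      case False
      then obtain s where s: "q = stack_number p s + 2" "s \<in> insert [] (stacks p)"
        using q by (auto simp: compile_def)
      show ?thesis
      proof (cases "s = []")
        case True
        then show ?thesis using idle s by (auto simp: compile_def r_def Let_def)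
      next
        case False
        then have s': "s \<in> stacks p" using s by simp
        have "\<forall>i<K. actions s r i \<in> \<Gamma> \<times> {-1, 0, 1}"
          using safe_actions[OF s' assms(1)] r unfolding safe_act_def by blast
        then have "set (map (actions s r) [0..<K]) \<subseteq> \<Gamma> \<times> {-1, 0, 1}"
          by (simp add: image_subset_iff)
        moreover have "stack_number p (next_stack s r) + 2 \<in> states (compile K \<Gamma> p acc)"
          using next_stack_in_stacks[OF s', of r] by (auto simp: compile_def)
        moreover have "trans (compile K \<Gamma> p acc) q ss =
            (stack_number p (next_stack s r) + 2, map (actions s r) [0..<K])"
          using s False by (simp add: compile_def r_def Let_def)
        ultimately show ?thesis by simp
      qed
    qed
  qed
  then show ?thesis
    using assms start_in_stacks[of p] finite_stacks[of p]
    by (auto simp: turing_machine_def compile_def)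
qed

lemma step_compile:
  assumes "safe K \<Gamma> p" "s \<in> stacks p"
    and "map view tapes = map ts [0..<K]" "\<forall>i\<ge>K. ts i = blank"
  obtains tapes' where
    "step (compile K \<Gamma> p acc) (stack_number p s + 2, tapes) =
       (stack_number p (next_stack s (reads ts)) + 2, tapes')"
    "map view tapes' = map (perform ts (actions s (reads ts))) [0..<K]"
    "\<forall>i\<ge>K. perform ts (actions s (reads ts)) i = blank"
proof -
  have len: "length tapes = K" using arg_cong[OF assms(3), of length] by simp
  have nth: "view (tapes ! i) = ts i" if "i < K" for i
    using arg_cong[OF assms(3), of "\<lambda>xs. xs ! i"] that len by simp
  have r: "padded K (map read_tape tapes) = reads ts"
    using nth len assms(4) by (auto simp: padded_def reads_def fun_eq_iff read_tape_view)
  let ?a = "actions s (reads ts)"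
  let ?t = "map2 act_tape tapes (map ?a [0..<K])"
  have "s \<noteq> []" using assms(2) Nil_notin_stacks by auto
  then have "step (compile K \<Gamma> p acc) (stack_number p s + 2, tapes) =
      (stack_number p (next_stack s (reads ts)) + 2, ?t)"
    using assms(2) by (simp add: step_def compile_def r Let_def)
  moreover have "map view ?t = map (perform ts ?a) [0..<K]"
    using len nth by (intro nth_equalityI) (auto simp: view_act_tape perform_def)
  moreover have "\<forall>i\<ge>K. perform ts ?a i = blank"
    using safe_actions[OF assms(2,1)] assms(4)
    by (auto simp: safe_act_def reads_def perform_def act_view_def)
  ultimately show ?thesis using that by blast
qed

text \<open>Lockstep lasts only until the stack is first empty: from then on the program idles,
  whereas the machine moves on to its verdict.\<close>

lemma funpow_step_compile:
  assumes "safe K \<Gamma> p" "map view tapes = map ts [0..<K]" "\<forall>i\<ge>K. ts i = blank"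
    and "(prog_step ^^ t) ([p], ts) = (s, ts')"
    and "\<And>t'. t' < t \<Longrightarrow> fst ((prog_step ^^ t') ([p], ts)) \<noteq> []"
  shows "\<exists>tapes'. (step (compile K \<Gamma> p acc) ^^ t) (stack_number p [p] + 2, tapes) =
      (stack_number p s + 2, tapes') \<and> map view tapes' = map ts' [0..<K] \<and>
      (\<forall>i\<ge>K. ts' i = blank) \<and> s \<in> insert [] (stacks p)"
  using assms(4,5)
proof (induction t arbitrary: s ts')
  case 0
  then show ?case using assms start_in_stacks by auto
next
  case (Suc t)
  obtain s1 ts1 where 1: "(prog_step ^^ t) ([p], ts) = (s1, ts1)" by fastforce
  from Suc.IH[OF 1] Suc.prems(2) obtain tapes1 where
    IH: "(step (compile K \<Gamma> p acc) ^^ t) (stack_number p [p] + 2, tapes) =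
      (stack_number p s1 + 2, tapes1)" "map view tapes1 = map ts1 [0..<K]"
      "\<forall>i\<ge>K. ts1 i = blank" "s1 \<in> insert [] (stacks p)"
    by auto
  have "s1 \<noteq> []" using Suc.prems(2)[of t] 1 by simp
  then have s1: "s1 \<in> stacks p" using IH by simp
  have 2: "s = next_stack s1 (reads ts1)" "ts' = perform ts1 (actions s1 (reads ts1))"
    using Suc.prems(1) 1 by auto
  from step_compile[OF assms(1) s1 IH(2,3), of acc] obtain tapes' where
    "step (compile K \<Gamma> p acc) (stack_number p s1 + 2, tapes1) =
       (stack_number p s + 2, tapes')"
    "map view tapes' = map ts' [0..<K]" "\<forall>i\<ge>K. ts' i = blank"
    unfolding 2 by metis
  moreover have "s \<in> insert [] (stacks p)" unfolding 2 using next_stack_in_stacks[OF s1] .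
  ultimately show ?case using IH(1) by auto
qed

lemma compile_halts:
  assumes "safe K \<Gamma> p" "map view tapes = map ts [0..<K]" "\<forall>i\<ge>K. ts i = blank"
    and "runs p ts n ts'"
  shows "\<exists>t \<le> Suc n. fst ((step (compile K \<Gamma> p acc) ^^ t) (stack_number p [p] + 2, tapes)) =
    (if acc (reads ts') then 0 else 1)"
proof -
  obtain t1 where t1: "t1 \<le> n" "(prog_step ^^ t1) ([p], ts) = ([], ts')"
    using assms(4) unfolding runs_def by blast
  \<comment> \<open>\<open>t1\<close> may lie beyond the first moment with an empty stack. The empty
    stack idles, so the tapes at time \<open>t\<close> are already the final ones.\<close>
  define t where "t = (LEAST t. fst ((prog_step ^^ t) ([p], ts)) = [])"
  have tt: "fst ((prog_step ^^ t) ([p], ts)) = []"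
    unfolding t_def by (rule LeastI[of _ t1]) (simp add: t1)
  have "t \<le> t1" unfolding t_def by (rule Least_le) (simp add: t1)
  have stuck: "(prog_step ^^ j) ([], x) = ([], x)" for j x
    by (induction j) (auto simp: perform_idle)
  have "(prog_step ^^ t1) ([p], ts) = (prog_step ^^ (t1 - t)) ((prog_step ^^ t) ([p], ts))"
    using \<open>t \<le> t1\<close> by (metis comp_apply funpow_add le_add_diff_inverse2)
  then have t: "(prog_step ^^ t) ([p], ts) = ([], ts')"
    using tt t1 by (cases "(prog_step ^^ t) ([p], ts)") (simp add: stuck)
  have "fst ((prog_step ^^ t') ([p], ts)) \<noteq> []" if "t' < t" for t'
    using not_less_Least that unfolding t_def by blast
  from funpow_step_compile[OF assms(1-3) t this, of acc]
  obtain tapes' where T: "(step (compile K \<Gamma> p acc) ^^ t) (stack_number p [p] + 2, tapes) =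
      (stack_number p [] + 2, tapes')" "map view tapes' = map ts' [0..<K]" "\<forall>i\<ge>K. ts' i = blank"
    by auto
  have len: "length tapes' = K" using arg_cong[OF T(2), of length] by simp
  have nth: "view (tapes' ! i) = ts' i" if "i < K" for i
    using arg_cong[OF T(2), of "\<lambda>xs. xs ! i"] that len by simp
  have r: "padded K (map read_tape tapes') = reads ts'"
    using nth len T(3) by (auto simp: padded_def reads_def fun_eq_iff read_tape_view)
  have "fst ((step (compile K \<Gamma> p acc) ^^ Suc t) (stack_number p [p] + 2, tapes)) =
    (if acc (reads ts') then 0 else 1)"
    using T(1) by (simp add: step_def compile_def r Let_def)
  then show ?thesis using \<open>t \<le> t1\<close> t1(1) by (intro exI[of _ "Suc t"]) auto
qed

section \<open>Tape contents\<close>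

definition ahead :: "nat list \<Rightarrow> view" where
  "ahead u = (\<lambda>d. if 0 \<le> d \<and> d < int (length u) then u ! nat d else 0)"

definition behind :: "nat list \<Rightarrow> view" where
  "behind u = shifted (ahead u) (int (length u))"

text \<open>A unary counter of \<open>a + b\<close> ones. Moving the head transfers between
  \<open>a\<close> and \<open>b\<close> without rewriting, so the same ones can be counted
  repeatedly. The arguments are integers because the head may stand on the blank just left of the
  ones, where \<open>a = -1\<close>.\<close>

definition bar :: "int \<Rightarrow> int \<Rightarrow> view" where
  "bar a b = (\<lambda>d. if - a \<le> d \<and> d < b then 1 else 0)"

definition cell :: "nat \<Rightarrow> view" where
  "cell s = blank(0 := s)"

definition supported :: "nat \<Rightarrow> view \<Rightarrow> bool" where
  "supported c v \<longleftrightarrow> (\<forall>d. \<bar>d\<bar> > int c \<longrightarrow> v d = 0)"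

lemma view_word_tape: "view (word_tape w) = ahead (map letter_symbol w)"
  by (auto simp: view_def word_tape_def ahead_def fun_eq_iff nat_less_iff)

lemma view_blank_tape: "view blank_tape = blank"
  by (simp add: view_def blank_tape_def)

lemma shifted_blank [simp]: "shifted blank s = blank"
  by (simp add: shifted_def)

lemma ahead_Nil [simp]: "ahead [] = blank"
  by (auto simp: ahead_def)

lemma behind_append: "act_view (behind u) (s, 1) = behind (u @ [s])"
  by (auto simp: behind_def ahead_def act_view_def shifted_def fun_eq_iff nth_append
      nat_add_distrib nat_less_iff intro!: arg_cong[of _ _ "\<lambda>i. u ! nat i"])

lemma behind_erase: "act_view (shifted (behind (u @ [s])) (-1)) (0, 0) = behind u"
  by (auto simp: behind_def ahead_def act_view_def shifted_def fun_eq_iff nth_append nat_less_iff)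

lemma ahead_Cons_left: "act_view (shifted (ahead u) (-1)) (s, -1) = shifted (ahead (s # u)) (-1)"
  by (auto simp: ahead_def act_view_def shifted_def fun_eq_iff nth_Cons' nat_less_iff nat_diff_distrib'
      intro!: arg_cong[of _ _ "\<lambda>i. u ! i"])

lemma ahead_Cons: "act_view (shifted (ahead u) (-1)) (s, 0) = ahead (s # u)"
  by (auto simp: ahead_def act_view_def shifted_def fun_eq_iff nth_Cons' nat_less_iff nat_diff_distrib'
      intro!: arg_cong[of _ _ "\<lambda>i. u ! i"])

lemma behind_nth: "i < length u \<Longrightarrow> behind u (- 1 - int i) = u ! (length u - Suc i)"
  by (auto simp: behind_def ahead_def shifted_def intro!: arg_cong[of _ _ "\<lambda>i. u ! i"])

lemma behind_start: "behind u (- 1 - int (length u)) = 0"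
  by (auto simp: behind_def ahead_def shifted_def)

lemma behind_0 [simp]: "behind u 0 = 0"
  by (auto simp: behind_def ahead_def shifted_def)

lemma cell_apply [simp]: "cell s 0 = s"
  by (simp add: cell_def)

lemma cell_0: "cell 0 = blank"
  by (auto simp: cell_def)

lemma act_view_cell [simp]: "act_view (cell s) (s', 0) = cell s'"
  by (auto simp: act_view_def cell_def)

lemma act_view_blank [simp]: "act_view blank (s', 0) = cell s'"
  by (auto simp: act_view_def cell_def)

lemma shifted_bar [simp]: "shifted (bar a b) s = bar (a + s) (b - s)"
  by (auto simp: shifted_def bar_def fun_eq_iff)

lemma bar_blank: "a + b \<le> 0 \<Longrightarrow> bar a b = blank"
  by (auto simp: bar_def fun_eq_iff)

lemma bar_extend: "a \<ge> 0 \<Longrightarrow> act_view (bar a 0) (Suc 0, 1) = bar (a + 1) 0"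
  by (auto simp: bar_def act_view_def fun_eq_iff)

lemma bar_shrink: "a \<ge> 0 \<Longrightarrow> act_view (bar a 1) (0, -1) = bar (a - 1) 1"
  by (auto simp: bar_def act_view_def fun_eq_iff)

lemma supported_act_view: "supported c v \<Longrightarrow> \<bar>snd a\<bar> \<le> 1 \<Longrightarrow> supported (Suc c) (act_view v a)"
  by (auto simp: supported_def act_view_def)

lemma supported_ahead: "length u \<le> Suc c \<Longrightarrow> supported c (ahead u)"
  by (auto simp: supported_def ahead_def)

lemma supported_blank: "supported c blank"
  by (auto simp: supported_def)

section \<open>Running a given machine on a composed word\<close>

text \<open>
  Layout of the tapes: tape 0 holds the word under construction, tapes \<open>1, \<dots>, k\<close> are the tapes
  of the given machine, and the next three hold its state, a unary clock that bounds how far its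
  tapes have been written, and the flag telling whether it has ever accepted.
\<close>

abbreviation (input) state_tape :: "nat \<Rightarrow> nat" where "state_tape k \<equiv> Suc k"
abbreviation (input) clock_tape :: "nat \<Rightarrow> nat" where "clock_tape k \<equiv> Suc (Suc k)"
abbreviation (input) flag_tape :: "nat \<Rightarrow> nat" where "flag_tape k \<equiv> Suc (Suc (Suc k))"

definition layout :: "nat \<Rightarrow> 'a \<Rightarrow> (nat \<Rightarrow> 'a) \<Rightarrow> 'a \<Rightarrow> 'a \<Rightarrow> 'a \<Rightarrow> (nat \<Rightarrow> 'a) \<Rightarrow> nat \<Rightarrow> 'a" where
  "layout k b ms q c f rest i =
     (if i = 0 then b else if i \<le> k then ms i else if i = state_tape k then q
      else if i = clock_tape k then c else if i = flag_tape k then f else rest i)"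

lemma layout_simps [simp]:
  "layout k b ms q c f rest 0 = b"
  "1 \<le> i \<Longrightarrow> i \<le> k \<Longrightarrow> layout k b ms q c f rest i = ms i"
  "layout k b ms q c f rest (state_tape k) = q"
  "layout k b ms q c f rest (clock_tape k) = c"
  "layout k b ms q c f rest (flag_tape k) = f"
  by (auto simp: layout_def)

lemma reads_layout [simp]:
  "reads (layout k b ms q c f rest) =
     layout k (b 0) (\<lambda>i. ms i 0) (q 0) (c 0) (f 0) (\<lambda>i. rest i 0)"
  by (auto simp: layout_def reads_def)

lemma layout_cong:
  "(\<And>i. 1 \<le> i \<Longrightarrow> i \<le> k \<Longrightarrow> ms i = ms' i) \<Longrightarrow>
   layout k b ms q c f rest = layout k b ms' q c f rest"
  by (auto simp: layout_def fun_eq_iff)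

definition act ::
  "nat \<Rightarrow> ((nat \<Rightarrow> nat) \<Rightarrow> nat \<times> int) \<Rightarrow> ((nat \<Rightarrow> nat) \<Rightarrow> nat \<Rightarrow> nat \<times> int) \<Rightarrow>
   ((nat \<Rightarrow> nat) \<Rightarrow> nat \<times> int) \<Rightarrow> ((nat \<Rightarrow> nat) \<Rightarrow> nat \<times> int) \<Rightarrow>
   ((nat \<Rightarrow> nat) \<Rightarrow> nat \<times> int) \<Rightarrow> prog" where
  "act k B W Q C F = Act (\<lambda>r. layout k (B r) (W r) (Q r) (C r) (F r) (\<lambda>i. (r i, 0)))"

definition stay :: "nat \<Rightarrow> (nat \<Rightarrow> nat) \<Rightarrow> nat \<times> int" where
  "stay i r = (r i, 0)"

definition left :: "nat \<Rightarrow> (nat \<Rightarrow> nat) \<Rightarrow> nat \<times> int" where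
  "left i r = (r i, -1)"

definition right :: "nat \<Rightarrow> (nat \<Rightarrow> nat) \<Rightarrow> nat \<times> int" where
  "right i r = (r i, 1)"

definition put :: "nat \<Rightarrow> int \<Rightarrow> (nat \<Rightarrow> nat) \<Rightarrow> nat \<times> int" where
  "put s d r = (s, d)"

lemmas act_simps = stay_def left_def right_def put_def

lemma runs_act:
  assumes "\<And>r. r = reads (layout k b ms q c f rest) \<Longrightarrow>
       act_view b (B r) = b' \<and> (\<forall>i. 1 \<le> i \<longrightarrow> i \<le> k \<longrightarrow> act_view (ms i) (W r i) = ms' i) \<and>
       act_view q (Q r) = q' \<and> act_view c (C r) = c' \<and> act_view f (F r) = f'"
  shows "runs (act k B W Q C F) (layout k b ms q c f rest) 1 (layout k b' ms' q' c' f' rest)"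
  unfolding act_def
  by (rule runs_Act, rule ext) (use assms[OF refl] in \<open>auto simp: perform_def layout_def\<close>)

text \<open>
  The word is copied from right to left, so that the head ends on its first letter. The symbols
  4 and 5 are those of \<^const>\<open>Open\<close> and \<^const>\<open>Close\<close>.
\<close>

definition copy_program :: "nat \<Rightarrow> nat \<Rightarrow> prog" where
  "copy_program k s =
     Seq (act k (stay 0) (\<lambda>r i. if i = 1 then (5, -1) else stay i r) (stay (state_tape k)) (put 1 1)
       (stay (flag_tape k)))
    (Seq (act k (left 0) (\<lambda>r i. if i = 1 then (5, -1) else stay i r) (stay (state_tape k)) (put 1 1)
       (stay (flag_tape k)))
    (Seq (While (\<lambda>r. r 0 \<noteq> 0)
       (act k (left 0) (\<lambda>r i. if i = 1 then (r 0, -1) else stay i r) (stay (state_tape k)) (put 1 1)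
          (stay (flag_tape k))))
    (Seq (act k (right 0) (\<lambda>r i. if i = 1 then (4, 0) else stay i r) (put s 0)
       (stay (clock_tape k)) (stay (flag_tape k)))
    (While (\<lambda>r. r 0 \<noteq> 0)
       (act k (right 0) (\<lambda>r i. stay i r) (stay (state_tape k)) (stay (clock_tape k))
          (stay (flag_tape k)))))))"

lemma blank_conv_bar: "blank = bar 0 0"
  by (simp add: bar_blank)

text \<open>The clock shows one less than the number of letters written: the final
  \<open>Open\<close> is under the head, and the last letter is at distance
  \<open>length u + 2\<close> from it.\<close>

lemma runs_copy_program:
  assumes "0 \<notin> set u" "k \<ge> 1"
  shows "runs (copy_program k s) (layout k (behind u) (\<lambda>_. blank) blank blank f rest)
     (4 * length u + 20)
     (layout k (behind u) ((\<lambda>_. blank)(1 := ahead (4 # u @ [5, 5]))) (cell s)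
        (bar (int (length u) + 2) 0) f rest)"
proof -
  let ?n = "length u"
  let ?ms = "\<lambda>v. (\<lambda>_::nat. blank)(1 := v)"
  have nz: "u ! i \<noteq> 0" if "i < ?n" for i using assms that nth_mem by metis
  \<comment> \<open>After \<open>i\<close> passes the last \<open>i\<close> letters of
    \<open>u\<close> stand before the two closing brackets, with one tick for each letter written.
    The states \<open>\<tau>\<close> only bring tape 0 back to its end.\<close>
  define \<sigma> where "\<sigma> i = layout k (shifted (behind u) (-1 - int i))
    (?ms (shifted (ahead (drop (?n - i) u @ [5, 5])) (-1))) blank (bar (int i + 2) 0) f rest" for i
  define \<tau> where "\<tau> i = layout k (shifted (behind u) (int i - int ?n))
    (?ms (ahead (4 # u @ [5, 5]))) (cell s) (bar (int ?n + 2) 0) f rest" for i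
  note loop1 = runs_While[where n = ?n and \<sigma> = \<sigma> and a = 1]
  note loop2 = runs_While[where n = ?n and \<sigma> = \<tau> and a = 1]
  have "runs (copy_program k s) (layout k (behind u) (?ms (shifted (ahead []) (-1))) blank (bar 0 0) f rest)
     (Suc (1 + Suc (1 + Suc ((?n * Suc 1 + 1) + Suc (1 + (?n * Suc 1 + 1)))))) (\<tau> ?n)"
    unfolding copy_program_def
  proof (intro runs_Seq)
    show "runs (act k (stay 0) (\<lambda>r i. if i = 1 then (5, -1) else stay i r) (stay (state_tape k))
        (put 1 1) (stay (flag_tape k)))
      (layout k (behind u) (?ms (shifted (ahead []) (-1))) blank (bar 0 0) f rest) 1
      (layout k (behind u) (?ms (shifted (ahead [5]) (-1))) blank (bar 1 0) f rest)"
      by (rule runs_act) (use ahead_Cons_left[of "[]" 5] bar_extend[of 0]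
         in \<open>auto simp: act_simps cell_0\<close>)
    show "runs (act k (left 0) (\<lambda>r i. if i = 1 then (5, -1) else stay i r) (stay (state_tape k))
        (put 1 1) (stay (flag_tape k)))
      (layout k (behind u) (?ms (shifted (ahead [5]) (-1))) blank (bar 1 0) f rest) 1 (\<sigma> 0)"
      unfolding \<sigma>_def
      by (rule runs_act)
        (use ahead_Cons_left[of "[5]" 5] bar_extend[of 1]
         in \<open>auto simp: act_simps cell_0\<close>)
    show "runs (While (\<lambda>r. r 0 \<noteq> 0)
       (act k (left 0) (\<lambda>r i. if i = 1 then (r 0, -1) else stay i r) (stay (state_tape k)) (put 1 1)
          (stay (flag_tape k)))) (\<sigma> 0) (?n * Suc 1 + 1) (\<sigma> ?n)"
    proof (rule loop1)
      show "reads (\<sigma> j) 0 \<noteq> 0" if "j < ?n" for j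
        using that by (simp add: \<sigma>_def behind_nth nz)
      show "\<not> reads (\<sigma> ?n) 0 \<noteq> 0" by (simp add: \<sigma>_def behind_start)
      show "runs (act k (left 0) (\<lambda>r i. if i = 1 then (r 0, -1) else stay i r) (stay (state_tape k))
        (put 1 1) (stay (flag_tape k))) (\<sigma> j) 1 (\<sigma> (Suc j))" if "j < ?n" for j
      proof -
        have d: "u ! (?n - Suc j) # drop (?n - j) u = drop (?n - Suc j) u"
          using that Cons_nth_drop_Suc[of "?n - Suc j" u] by (simp add: Suc_diff_Suc)
        have a: "act_view (shifted (ahead (drop (?n - j) u @ [5, 5])) (-1)) (u ! (?n - Suc j), -1) =
          shifted (ahead (drop (?n - Suc j) u @ [5, 5])) (-1)"
          unfolding ahead_Cons_left append_Cons[symmetric] d ..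
        have b: "act_view (shifted (behind u) (-1 - int j)) (u ! (?n - Suc j), -1) =
            shifted (behind u) (-2 - int j)"
          using that act_view_same[OF refl, of "shifted (behind u) (-1 - int j)" "-1"] by (simp add: behind_nth)
        show ?thesis unfolding \<sigma>_def
          by (rule runs_act)
            (use that a b bar_extend[of "int j + 2"] in \<open>auto simp: act_simps cell_0 behind_nth\<close>)
      qed
    qed
    show "runs (act k (right 0) (\<lambda>r i. if i = 1 then (4, 0) else stay i r) (put s 0)
       (stay (clock_tape k)) (stay (flag_tape k))) (\<sigma> ?n) 1 (\<tau> 0)"
      unfolding \<sigma>_def \<tau>_def
      by (rule runs_act)
        (use act_view_same[OF refl, of "shifted (behind u) (-1 - int ?n)" 1] behind_start[of u]
         in \<open>auto simp: act_simps ahead_Cons cell_0\<close>)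
    show "runs (While (\<lambda>r. r 0 \<noteq> 0)
       (act k (right 0) (\<lambda>r i. stay i r) (stay (state_tape k)) (stay (clock_tape k))
          (stay (flag_tape k)))) (\<tau> 0) (?n * Suc 1 + 1) (\<tau> ?n)"
    proof (rule loop2)
      show "reads (\<tau> j) 0 \<noteq> 0" if "j < ?n" for j
        using that behind_nth[of "?n - Suc j" u] nz[of j] by (simp add: \<tau>_def of_nat_diff)
      show "\<not> reads (\<tau> ?n) 0 \<noteq> 0" by (simp add: \<tau>_def)
      show "runs (act k (right 0) (\<lambda>r i. stay i r) (stay (state_tape k)) (stay (clock_tape k))
          (stay (flag_tape k))) (\<tau> j) 1 (\<tau> (Suc j))" for j
        unfolding \<tau>_def
        by (rule runs_act)
          (use act_view_same[OF refl, of "shifted (behind u) (int j - int ?n)" 1] in \<open>auto simp: act_simps algebra_simps\<close>)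
    qed
  qed
  then have "runs (copy_program k s) (layout k (behind u) (\<lambda>_. blank) blank blank f rest)
     (Suc (1 + Suc (1 + Suc ((?n * Suc 1 + 1) + Suc (1 + (?n * Suc 1 + 1)))))) (\<tau> ?n)"
    by (simp add: blank_conv_bar[symmetric] fun_upd_def)
  moreover have "\<tau> ?n = layout k (behind u) (?ms (ahead (4 # u @ [5, 5]))) (cell s)
      (bar (int ?n + 2) 0) f rest"
    by (simp add: \<tau>_def)
  ultimately show ?thesis by (auto elim!: runs_mono)
qed

section \<open>Step-by-step simulation of the given machine\<close>

definition machine_move :: "tm \<Rightarrow> (nat \<Rightarrow> nat) \<Rightarrow> nat \<times> (nat \<times> int) list" where
  "machine_move M r =
     (let k = tape_count M; q = r (state_tape k); ss = map r [1..<Suc k] in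
      if q \<in> states M \<and> set ss \<subseteq> symbols M then trans M q ss else (q, map (\<lambda>s. (s, 0)) ss))"

definition simulation_program :: "tm \<Rightarrow> prog" where
  "simulation_program M =
     (let k = tape_count M in
      While (\<lambda>r. r (state_tape k) \<notin> {accept M, reject M})
        (act k (stay 0) (\<lambda>r i. snd (machine_move M r) ! (i - 1)) (\<lambda>r. (fst (machine_move M r), 0))
          (put 1 1) (stay (flag_tape k))))"

definition config_within :: "tm \<Rightarrow> config \<Rightarrow> bool" where
  "config_within M c \<longleftrightarrow> fst c \<in> states M \<and> length (snd c) = tape_count M \<and>
     (\<forall>t \<in> set (snd c). range (view t) \<subseteq> symbols M)"

lemma range_act_view: "range v \<subseteq> A \<Longrightarrow> fst a \<in> A \<Longrightarrow> range (act_view v a) \<subseteq> A"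
  by (auto simp: act_view_def)

lemma turing_machine_trans:
  assumes "turing_machine M" "q \<in> states M" "length ss = tape_count M" "set ss \<subseteq> symbols M"
    and "trans M q ss = (q', as)"
  shows "q' \<in> states M \<and> length as = tape_count M \<and> set as \<subseteq> symbols M \<times> {-1, 0, 1}"
proof -
  have "\<forall>q \<in> states M. \<forall>ss. length ss = tape_count M \<and> set ss \<subseteq> symbols M \<longrightarrow>
      (case trans M q ss of (q', as) \<Rightarrow>
         q' \<in> states M \<and> length as = tape_count M \<and> set as \<subseteq> symbols M \<times> {-1, 0, 1})"
    using assms(1) unfolding turing_machine_def by (elim conjE) assumption
  from bspec[OF this assms(2), THEN spec[of _ ss]] show ?thesis
    using assms(3-5) by simp
qed

lemma read_tapes_within:
  assumes "config_within M c"
  shows "set (map read_tape (snd c)) \<subseteq> symbols M"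
proof -
  have "view t 0 \<in> symbols M" if "t \<in> set (snd c)" for t
    using assms that unfolding config_within_def by blast
  then show ?thesis by (auto simp: read_tape_view)
qed

lemma step_within:
  assumes M: "turing_machine M" and c: "config_within M c"
    and nonfinal: "fst c \<notin> {accept M, reject M}"
  shows "\<exists>as. trans M (fst c) (map read_tape (snd c)) = (fst (step M c), as) \<and>
     snd (step M c) = map2 act_tape (snd c) as \<and> length as = tape_count M \<and>
     set as \<subseteq> symbols M \<times> {-1, 0, 1} \<and> config_within M (step M c)"
proof -
  obtain q' as where t: "trans M (fst c) (map read_tape (snd c)) = (q', as)" by fastforce
  have ss: "length (map read_tape (snd c)) = tape_count M"
    "set (map read_tape (snd c)) \<subseteq> symbols M"
    using c read_tapes_within[OF c] by (simp_all add: config_within_def)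
  have a: "q' \<in> states M" "length as = tape_count M" "set as \<subseteq> symbols M \<times> {-1, 0, 1}"
    using turing_machine_trans[OF M _ ss t] c by (simp_all add: config_within_def)
  have st: "step M c = (q', map2 act_tape (snd c) as)"
    using nonfinal t by (simp add: step_def)
  have "range (view (act_tape t x)) \<subseteq> symbols M" if "(t, x) \<in> set (zip (snd c) as)" for t x
  proof -
    have "fst x \<in> symbols M" using set_zip_rightD[OF that] a(3) by (cases x) auto
    moreover have "range (view t) \<subseteq> symbols M"
      using set_zip_leftD[OF that] c by (auto simp: config_within_def)
    ultimately show ?thesis unfolding view_act_tape by (intro range_act_view)
  qed
  then have "config_within M (step M c)"
    using a c unfolding st config_within_def by fastforce
  then show ?thesis using t a st by auto
qed

lemma config_within_initial:
  assumes "turing_machine M"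
  shows "config_within M (initial M w)"
proof -
  have "range (view (word_tape w)) \<subseteq> symbols M"
    using assms by (auto simp: view_word_tape ahead_def turing_machine_def)
  then show ?thesis
    using assms by (auto simp: config_within_def initial_def turing_machine_def view_blank_tape)
qed

lemma config_within_funpow:
  assumes "turing_machine M" "config_within M c"
  shows "config_within M ((step M ^^ n) c)"
proof (induction n)
  case (Suc n)
  show ?case
  proof (cases "fst ((step M ^^ n) c) \<in> {accept M, reject M}")
    case True
    then have "step M ((step M ^^ n) c) = (step M ^^ n) c" by (simp add: step_def)
    then show ?thesis using Suc by simp
  next
    case False
    then show ?thesis using step_within[OF assms(1) Suc] by auto
  qed
qed (use assms in simp)

definition embedded :: "nat \<Rightarrow> config \<Rightarrow> view \<Rightarrow> view \<Rightarrow> view \<Rightarrow> (nat \<Rightarrow> view) \<Rightarrow> nat \<Rightarrow> view" where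
  "embedded k c b clock f rest =
     layout k b (\<lambda>i. view (snd c ! (i - 1))) (cell (fst c)) clock f rest"

text \<open>The loop stops at the first final state, so \<open>t\<close> has to be the exact halting
  time and not just a bound for it.\<close>

lemma runs_simulation_program:
  assumes M: "turing_machine M" and c: "config_within M c"
    and running: "\<And>j. j < t \<Longrightarrow> fst ((step M ^^ j) c) \<notin> {accept M, reject M}"
    and final: "fst ((step M ^^ t) c) \<in> {accept M, reject M}"
  shows "runs (simulation_program M) (embedded (tape_count M) c b (bar (int n) 0) f rest)
     (2 * t + 1) (embedded (tape_count M) ((step M ^^ t) c) b (bar (int (n + t)) 0) f rest)"
proof -
  define k where "k = tape_count M"
  define \<sigma> where "\<sigma> j = embedded k ((step M ^^ j) c) b (bar (int (n + j)) 0) f rest" for j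
  have "runs (simulation_program M) (\<sigma> 0) (t * Suc 1 + 1) (\<sigma> t)"
    unfolding simulation_program_def Let_def k_def[symmetric]
  proof (rule runs_While)
    show "reads (\<sigma> j) (state_tape k) \<notin> {accept M, reject M}" if "j < t" for j
      using running[OF that] by (simp add: \<sigma>_def embedded_def)
    show "\<not> reads (\<sigma> t) (state_tape k) \<notin> {accept M, reject M}"
      using final by (simp add: \<sigma>_def embedded_def)
    show "runs (act k (stay 0) (\<lambda>r i. snd (machine_move M r) ! (i - 1))
        (\<lambda>r. (fst (machine_move M r), 0)) (put 1 1) (stay (flag_tape k))) (\<sigma> j) 1 (\<sigma> (Suc j))"
      if "j < t" for j
    proof -
      define d where "d = (step M ^^ j) c"
      have d: "config_within M d" unfolding d_def by (rule config_within_funpow[OF M c])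
      have nf: "fst d \<notin> {accept M, reject M}" using running[OF that] by (simp add: d_def)
      obtain as where as: "trans M (fst d) (map read_tape (snd d)) = (fst (step M d), as)"
        "snd (step M d) = map2 act_tape (snd d) as" "length as = k"
        using step_within[OF M d nf] k_def by auto
      have len: "length (snd d) = k" using d by (simp add: config_within_def k_def)
      define r where "r = reads (embedded k d b (bar (int (n + j)) 0) f rest)"
      have q: "r (state_tape k) = fst d" by (simp add: r_def embedded_def)
      have ss: "map r [1..<Suc k] = map read_tape (snd d)"
        using len by (intro nth_equalityI) (auto simp: r_def embedded_def read_tape_view simp del: upt_Suc)
      have "set (map read_tape (snd d)) \<subseteq> symbols M" "fst d \<in> states M"
        using d read_tapes_within[OF d] by (simp_all add: config_within_def)
      then have mv: "machine_move M r = (fst (step M d), as)"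
        using as(1) unfolding machine_move_def Let_def k_def[symmetric] q ss by simp
      have st: "act_view (view (snd d ! (i - 1))) (as ! (i - 1)) = view (snd (step M d) ! (i - 1))"
        if "1 \<le> i" "i \<le> k" for i
        using that as len by (simp add: view_act_tape)
      have e: "(step M ^^ Suc j) c = step M d" by (simp add: d_def)
      show ?thesis
        unfolding \<sigma>_def e d_def[symmetric]
        unfolding embedded_def
      proof (rule runs_act)
        fix r'
        assume "r' = reads (layout k b (\<lambda>i. view (snd d ! (i - 1))) (cell (fst d))
          (bar (int (n + j)) 0) f rest)"
        then have "r' = r" by (simp only: r_def embedded_def)
        moreover have "r 0 = b 0" "r (flag_tape k) = f 0" by (simp_all add: r_def embedded_def)
        ultimately show "act_view b (stay 0 r') = b \<and>
          (\<forall>i. 1 \<le> i \<longrightarrow> i \<le> k \<longrightarrow> act_view (view (snd d ! (i - 1))) (snd (machine_move M r') ! (i - 1)) =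
            view (snd (step M d) ! (i - 1))) \<and>
          act_view (cell (fst d)) (fst (machine_move M r'), 0) = cell (fst (step M d)) \<and>
          act_view (bar (int (n + j)) 0) (put 1 1 r') = bar (int (n + Suc j)) 0 \<and>
          act_view f (stay (flag_tape k) r') = f"
          using mv st bar_extend[of "int (n + j)"] by (simp add: act_simps add_ac)
      qed
    qed
  qed
  then show ?thesis by (simp add: \<sigma>_def k_def mult_2)
qed

text \<open>A step writes under the head and then moves it by at most one cell, so the radius grows
  by at most one, exactly as the clock does.\<close>

lemma supported_funpow_step:
  assumes M: "turing_machine M" and c: "config_within M c" and i: "i < tape_count M"
    and s: "supported n (view (snd c ! i))"
  shows "supported (n + t) (view (snd ((step M ^^ t) c) ! i))"
proof (induction t)
  case (Suc t)
  define d where "d = (step M ^^ t) c"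
  have d: "config_within M d" unfolding d_def by (rule config_within_funpow[OF M c])
  show ?case
  proof (cases "fst d \<in> {accept M, reject M}")
    case True
    then have "step M d = d" by (simp add: step_def)
    then show ?thesis using Suc by (auto simp: d_def[symmetric] supported_def)
  next
    case False
    from step_within[OF M d False] obtain as where as:
      "snd (step M d) = map2 act_tape (snd d) as" "length as = tape_count M"
      "set as \<subseteq> symbols M \<times> {-1, 0, 1}" by auto
    have "as ! i \<in> symbols M \<times> {-1, 0, 1}" using as i nth_mem by fastforce
    then have "\<bar>snd (as ! i)\<bar> \<le> 1" by auto
    moreover have "length (snd d) = tape_count M" using d by (simp add: config_within_def)
    ultimately show ?thesis
      using Suc as i by (simp add: d_def[symmetric] view_act_tape supported_act_view)
  qed
qed (use s in simp)

text \<open>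
  If the clock shows \<open>n\<close>, every nonblank cell of the given machine's tapes is within distance
  \<open>n\<close> of the head. It suffices to move \<open>n\<close> cells to the left and then to erase \<open>2n + 1\<close>
  cells; the clock serves as loop counter for the move and for both halves of the erasure.
\<close>

definition clean_program :: "tm \<Rightarrow> prog" where
  "clean_program M =
     (let k = tape_count M in
      Seq (act k (stay 0) (\<lambda>r i. stay i r) (put 0 0) (left (clock_tape k))
        (\<lambda>r. (if r (state_tape k) = accept M then 1 else r (flag_tape k), 0)))
     (Seq (While (\<lambda>r. r (clock_tape k) \<noteq> 0)
        (act k (stay 0) (\<lambda>r i. left i r) (stay (state_tape k)) (left (clock_tape k)) (stay (flag_tape k))))
     (Seq (act k (stay 0) (\<lambda>r i. stay i r) (stay (state_tape k)) (right (clock_tape k)) (stay (flag_tape k)))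
     (Seq (While (\<lambda>r. r (clock_tape k) \<noteq> 0)
        (act k (stay 0) (\<lambda>r i. (0, 1)) (stay (state_tape k)) (right (clock_tape k)) (stay (flag_tape k))))
     (Seq (act k (stay 0) (\<lambda>r i. stay i r) (stay (state_tape k)) (left (clock_tape k)) (stay (flag_tape k)))
     (Seq (While (\<lambda>r. r (clock_tape k) \<noteq> 0)
        (act k (stay 0) (\<lambda>r i. (0, 1)) (stay (state_tape k)) (put 0 (-1)) (stay (flag_tape k))))
     (act k (stay 0) (\<lambda>r i. (0, 0)) (stay (state_tape k)) (stay (clock_tape k)) (stay (flag_tape k)))))))))"

text \<open>The tape contents \<open>v\<close> after a move by \<open>n\<close> to the left and \<open>i\<close> erasures.\<close>

definition wiped :: "nat \<Rightarrow> view \<Rightarrow> nat \<Rightarrow> view" where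
  "wiped n v i = (\<lambda>d. if d < 0 then 0 else v (d + int i - int n))"

text \<open>Support within radius \<open>n\<close> makes everything to the left of the new head
  position blank already.\<close>

lemma wiped_0: "supported n v \<Longrightarrow> wiped n v 0 = shifted v (- int n)"
  by (auto simp: wiped_def supported_def shifted_def fun_eq_iff)

lemma wiped_Suc: "act_view (wiped n v i) (0, 1) = wiped n v (Suc i)"
  by (auto simp: wiped_def act_view_def fun_eq_iff algebra_simps)

lemma wiped_end: "supported n v \<Longrightarrow> act_view (wiped n v (n + n)) (0, 0) = blank"
  by (auto simp: wiped_def act_view_def supported_def fun_eq_iff)

lemma bar_apply_0: "bar a b 0 = (if 0 \<le> a \<and> 0 < b then 1 else 0)"
  by (simp add: bar_def)

text \<open>The first action blanks the state and, reading it for the last time, records an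
  acceptance in the flag; a flag that is set stays set.\<close>

lemma runs_clean_program:
  fixes n :: nat
  assumes k: "k = tape_count M" and s: "\<And>i. 1 \<le> i \<Longrightarrow> i \<le> k \<Longrightarrow> supported n (ms i)"
  shows "runs (clean_program M) (layout k b ms (cell q) (bar (int n) 0) (cell x) rest) (6 * n + 20)
     (layout k b (\<lambda>_. blank) blank blank (cell (if q = accept M then 1 else x)) rest)"
proof -
  define f where "f = cell (if q = accept M then 1 else x)"
  \<comment> \<open>\<open>\<sigma>\<close> is the move to the left, \<open>\<tau>\<close> and
    \<open>\<rho>\<close> are the two halves of the erasure. In \<open>\<rho>\<close> the clock is
    consumed from its right end, so it is blank afterwards.\<close>
  define \<sigma> where "\<sigma> i = layout k b (\<lambda>j. shifted (ms j) (- int i)) blank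
    (bar (int n - 1 - int i) (1 + int i)) f rest" for i
  define \<tau> where "\<tau> i = layout k b (\<lambda>j. wiped n (ms j) i) blank (bar (int i) (int n - int i)) f rest" for i
  define \<rho> where "\<rho> i = layout k b (\<lambda>j. wiped n (ms j) (n + i)) blank
    (bar (int n - 1 - int i) 1) f rest" for i
  have "runs (clean_program M) (layout k b ms (cell q) (bar (int n) 0) (cell x) rest)
     (Suc (1 + Suc ((n * Suc 1 + 1) + Suc (1 + Suc ((n * Suc 1 + 1) + Suc (1 +
        Suc ((n * Suc 1 + 1) + 1)))))))
     (layout k b (\<lambda>_. blank) blank blank f rest)"
    unfolding clean_program_def Let_def k[symmetric]
  proof (intro runs_Seq)
    show "runs (act k (stay 0) (\<lambda>r i. stay i r) (put 0 0) (left (clock_tape k))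
        (\<lambda>r. (if r (state_tape k) = accept M then 1 else r (flag_tape k), 0)))
      (layout k b ms (cell q) (bar (int n) 0) (cell x) rest) 1 (\<sigma> 0)"
      unfolding \<sigma>_def by (rule runs_act) (auto simp: act_simps cell_0 f_def)
    show "runs (While (\<lambda>r. r (clock_tape k) \<noteq> 0)
        (act k (stay 0) (\<lambda>r i. left i r) (stay (state_tape k)) (left (clock_tape k)) (stay (flag_tape k))))
        (\<sigma> 0) (n * Suc 1 + 1) (\<sigma> n)"
    proof (rule runs_While)
      show "runs (act k (stay 0) (\<lambda>r i. left i r) (stay (state_tape k)) (left (clock_tape k))
          (stay (flag_tape k))) (\<sigma> j) 1 (\<sigma> (Suc j))" for j
        unfolding \<sigma>_def by (rule runs_act) (auto simp: act_simps cell_0 add_ac)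
    qed (auto simp: \<sigma>_def bar_apply_0)
    have "bar 0 (int n) = bar (int 0) (int n - int 0)" by simp
    then show "runs (act k (stay 0) (\<lambda>r i. stay i r) (stay (state_tape k)) (right (clock_tape k))
        (stay (flag_tape k))) (\<sigma> n) 1 (\<tau> 0)"
      unfolding \<sigma>_def \<tau>_def by (intro runs_act) (use s in \<open>auto simp: act_simps cell_0 wiped_0\<close>)
    show "runs (While (\<lambda>r. r (clock_tape k) \<noteq> 0)
        (act k (stay 0) (\<lambda>r i. (0, 1)) (stay (state_tape k)) (right (clock_tape k)) (stay (flag_tape k))))
        (\<tau> 0) (n * Suc 1 + 1) (\<tau> n)"
    proof (rule runs_While)
      show "runs (act k (stay 0) (\<lambda>r i. (0, 1)) (stay (state_tape k)) (right (clock_tape k))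
          (stay (flag_tape k))) (\<tau> j) 1 (\<tau> (Suc j))" for j
        unfolding \<tau>_def by (rule runs_act) (auto simp: act_simps cell_0 wiped_Suc algebra_simps)
    qed (auto simp: \<tau>_def bar_apply_0)
    show "runs (act k (stay 0) (\<lambda>r i. stay i r) (stay (state_tape k)) (left (clock_tape k))
        (stay (flag_tape k))) (\<tau> n) 1 (\<rho> 0)"
      unfolding \<rho>_def \<tau>_def by (rule runs_act) (auto simp: act_simps cell_0)
    show "runs (While (\<lambda>r. r (clock_tape k) \<noteq> 0)
        (act k (stay 0) (\<lambda>r i. (0, 1)) (stay (state_tape k)) (put 0 (-1)) (stay (flag_tape k))))
        (\<rho> 0) (n * Suc 1 + 1) (\<rho> n)"
    proof (rule runs_While)
      show "runs (act k (stay 0) (\<lambda>r i. (0, 1)) (stay (state_tape k)) (put 0 (-1))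
          (stay (flag_tape k))) (\<rho> j) 1 (\<rho> (Suc j))" if "j < n" for j
        unfolding \<rho>_def
        by (rule runs_act)
          (use that bar_shrink[of "int n - 1 - int j"] in
            \<open>auto simp: act_simps cell_0 wiped_Suc algebra_simps\<close>)
    qed (auto simp: \<rho>_def bar_apply_0)
    show "runs (act k (stay 0) (\<lambda>r i. (0, 0)) (stay (state_tape k)) (stay (clock_tape k))
        (stay (flag_tape k))) (\<rho> n) 1 (layout k b (\<lambda>_. blank) blank blank f rest)"
      unfolding \<rho>_def
      by (rule runs_act) (use s in \<open>auto simp: act_simps cell_0 wiped_end bar_blank\<close>)
  qed
  then show ?thesis unfolding f_def by (rule runs_mono) simp
qed

section \<open>One complete test of a candidate word\<close>

definition test_program :: "tm \<Rightarrow> prog" where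
  "test_program M =
     Seq (copy_program (tape_count M) (start M)) (Seq (simulation_program M) (clean_program M))"

text \<open>\<open>u\<close> is meant to consist of an instance, the \<open>Open\<close> of the
  coalition's vote list, and votes. The two \<open>Close\<close> end that list and the pair.\<close>

definition wrapped :: "letter list \<Rightarrow> letter list" where
  "wrapped u = Open # u @ [Close, Close]"

text \<open>Copying costs \<open>4 * n\<close>, simulating \<open>t\<close> steps costs
  \<open>2 * t\<close>, and erasing within radius \<open>n + 2 + t\<close> costs six times that
  radius, up to constants absorbed in 80; \<open>n + 3\<close> is the length of the wrapped
  word.\<close>

definition test_time :: "nat poly \<Rightarrow> nat \<Rightarrow> nat" where
  "test_time p n = 10 * n + 8 * poly p (n + 3) + 80"

lemma letter_symbol_pos [simp]: "0 < letter_symbol a"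
  by (cases a) auto

lemma letter_symbol_nonzero: "0 \<notin> set (map letter_symbol u)"
  by (induction u) (simp_all add: less_imp_neq)

lemma runs_test_program_layout:
  assumes M: "turing_machine M" and dec: "decides_in_time M E (poly p)" and k: "k = tape_count M"
  shows "runs (test_program M)
     (layout k (behind (map letter_symbol u)) (\<lambda>_. blank) blank blank (cell x) rest)
     (test_time p (length u))
     (layout k (behind (map letter_symbol u)) (\<lambda>_. blank) blank blank
       (cell (if wrapped u \<in> E then 1 else x)) rest)"
proof -
  let ?b = "behind (map letter_symbol u)" and ?w = "wrapped u" and ?c = "length u + 2"
  have k1: "k \<ge> 1" using M k by (simp add: turing_machine_def)
  obtain t' where t': "t' \<le> poly p (length ?w)"
    "fst ((step M ^^ t') (initial M ?w)) = (if ?w \<in> E then accept M else reject M)"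
    using dec unfolding decides_in_time_def by blast
  \<comment> \<open>\<open>t'\<close> is some time at which the verdict stands, while the simulation
    ends at the first such time. Final configurations do not change, so the verdict is the
    same.\<close>
  define t where "t = (LEAST t. fst ((step M ^^ t) (initial M ?w)) \<in> {accept M, reject M})"
  have final: "fst ((step M ^^ t) (initial M ?w)) \<in> {accept M, reject M}"
    unfolding t_def by (rule LeastI[of _ t']) (use t' in auto)
  have "t \<le> t'" unfolding t_def by (rule Least_le) (use t' in auto)
  have running: "fst ((step M ^^ j) (initial M ?w)) \<notin> {accept M, reject M}" if "j < t" for j
    using not_less_Least that unfolding t_def by blast
  have stuck: "(step M ^^ j) c = c" if "fst c \<in> {accept M, reject M}" for j c
    using that by (induction j) (auto simp: step_def)
  have "(step M ^^ t') (initial M ?w) = (step M ^^ (t' - t)) ((step M ^^ t) (initial M ?w))"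
    using \<open>t \<le> t'\<close> by (metis comp_apply funpow_add le_add_diff_inverse2)
  then have verdict: "fst ((step M ^^ t) (initial M ?w)) = (if ?w \<in> E then accept M else reject M)"
    using t' stuck[OF final] by simp
  have init: "config_within M (initial M ?w)" by (rule config_within_initial[OF M])
  define d where "d = (step M ^^ t) (initial M ?w)"
  have start: "embedded k (initial M ?w) ?b (bar (int ?c) 0) (cell x) rest =
     layout k ?b ((\<lambda>_. blank)(1 := ahead (4 # map letter_symbol u @ [5, 5])))
       (cell (start M)) (bar (int (length (map letter_symbol u)) + 2) 0) (cell x) rest"
  proof -
    have "view (snd (initial M ?w) ! (i - 1)) =
        ((\<lambda>_. blank)(1 := ahead (4 # map letter_symbol u @ [5, 5]))) i" if "1 \<le> i" "i \<le> k" for i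
      using that k by (cases "i = 1")
        (auto simp: initial_def view_word_tape wrapped_def view_blank_tape nth_Cons')
    then have "embedded k (initial M ?w) ?b (bar (int ?c) 0) (cell x) rest =
       layout k ?b ((\<lambda>_. blank)(1 := ahead (4 # map letter_symbol u @ [5, 5])))
         (cell (fst (initial M ?w))) (bar (int ?c) 0) (cell x) rest"
      unfolding embedded_def by (rule layout_cong)
    then show ?thesis by (simp add: initial_def add.commute)
  qed
  have supp: "supported (?c + t) (view (snd d ! (i - 1)))" if "1 \<le> i" "i \<le> k" for i
    unfolding d_def
  proof (rule supported_funpow_step[OF M init])
    show "i - 1 < tape_count M" using that k by simp
    show "supported ?c (view (snd (initial M ?w) ! (i - 1)))"
      using that k by (cases "i = 1")
        (auto simp: initial_def view_word_tape wrapped_def view_blank_tape nth_Cons'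
          supported_blank intro!: supported_ahead)
  qed
  have "runs (test_program M) (layout k ?b (\<lambda>_. blank) blank blank (cell x) rest)
     (Suc ((4 * length (map letter_symbol u) + 20) + Suc ((2 * t + 1) + (6 * (?c + t) + 20))))
     (layout k ?b (\<lambda>_. blank) blank blank
       (cell (if fst d = accept M then 1 else x)) rest)"
    unfolding test_program_def k[symmetric]
  proof (intro runs_Seq)
    show "runs (copy_program k (start M)) (layout k ?b (\<lambda>_. blank) blank blank (cell x) rest)
      (4 * length (map letter_symbol u) + 20)
      (embedded k (initial M ?w) ?b (bar (int ?c) 0) (cell x) rest)"
      unfolding start by (rule runs_copy_program[OF letter_symbol_nonzero k1])
    show "runs (simulation_program M) (embedded k (initial M ?w) ?b (bar (int ?c) 0) (cell x) rest)
      (2 * t + 1) (embedded k d ?b (bar (int (?c + t)) 0) (cell x) rest)"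
      unfolding d_def k by (rule runs_simulation_program[OF M init running final])
    show "runs (clean_program M) (embedded k d ?b (bar (int (?c + t)) 0) (cell x) rest)
      (6 * (?c + t) + 20)
      (layout k ?b (\<lambda>_. blank) blank blank (cell (if fst d = accept M then 1 else x)) rest)"
      unfolding embedded_def by (rule runs_clean_program[OF k supp])
  qed
  moreover have "fst d = accept M \<longleftrightarrow> ?w \<in> E"
    using verdict M by (auto simp: d_def turing_machine_def)
  moreover have "t \<le> poly p (length u + 3)"
    using \<open>t \<le> t'\<close> t'(1) by (simp add: wrapped_def numeral_3_eq_3)
  ultimately show ?thesis by (auto elim!: runs_mono simp: test_time_def)
qed

text \<open>Tapes beyond the flag are left unconstrained, so that the same condition serves at every
  level of the nested loops.\<close>

definition ready :: "nat \<Rightarrow> (nat \<Rightarrow> view) \<Rightarrow> letter list \<Rightarrow> nat \<Rightarrow> bool" where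
  "ready k ts u x \<longleftrightarrow> ts 0 = behind (map letter_symbol u) \<and>
     (\<forall>i. 1 \<le> i \<longrightarrow> i \<le> clock_tape k \<longrightarrow> ts i = blank) \<and> ts (flag_tape k) = cell x"

lemma runs_test_program:
  assumes "turing_machine M" "decides_in_time M E (poly p)" "ready (tape_count M) ts u x"
  shows "runs (test_program M) ts (test_time p (length u))
     (ts(flag_tape (tape_count M) := cell (if wrapped u \<in> E then 1 else x)))"
proof -
  let ?k = "tape_count M"
  have "layout ?k (behind (map letter_symbol u)) (\<lambda>_. blank) blank blank (cell x) ts = ts"
    "layout ?k (behind (map letter_symbol u)) (\<lambda>_. blank) blank blank
       (cell (if wrapped u \<in> E then 1 else x)) ts =
     ts(flag_tape ?k := cell (if wrapped u \<in> E then 1 else x))"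
    using assms(3) by (auto simp: ready_def layout_def fun_eq_iff)
  then show ?thesis
    using runs_test_program_layout[OF assms(1,2) refl, of u x ts] by metis
qed

section \<open>Exhaustive search over multiplicities\<close>

definition tape_act :: "nat \<Rightarrow> (nat \<Rightarrow> nat \<times> int) \<Rightarrow> prog" where
  "tape_act i a = Act (\<lambda>r. (\<lambda>j. (r j, 0))(i := a (r i)))"

lemma runs_tape_act:
  "act_view (ts i) (a (ts i 0)) = v \<Longrightarrow> runs (tape_act i a) ts 1 (ts(i := v))"
  unfolding tape_act_def by (rule runs_Act) (auto simp: perform_def reads_def fun_eq_iff)

text \<open>There is no empty program, so the base case spends one idle step.\<close>

fun append_program :: "letter list \<Rightarrow> prog" where
  "append_program [] = tape_act 0 (\<lambda>s. (s, 0))"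
| "append_program (a # v) = Seq (tape_act 0 (\<lambda>s. (letter_symbol a, 1))) (append_program v)"

fun erase_program :: "nat \<Rightarrow> prog" where
  "erase_program 0 = tape_act 0 (\<lambda>s. (s, 0))"
| "erase_program (Suc n) =
     Seq (tape_act 0 (\<lambda>s. (s, -1))) (Seq (tape_act 0 (\<lambda>s. (0, 0))) (erase_program n))"

lemma runs_append_program:
  assumes "ts 0 = behind (map letter_symbol u)"
  shows "runs (append_program v) ts (2 * length v + 1) (ts(0 := behind (map letter_symbol (u @ v))))"
  using assms
proof (induction v arbitrary: u ts)
  case Nil
  show ?case
    unfolding append_program.simps erase_program.simps list.size
    by (intro runs_mono[OF runs_tape_act]) (use Nil in simp_all)
next
  case (Cons a v)
  let ?ts = "ts(0 := behind (map letter_symbol (u @ [a])))"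
  have "runs (tape_act 0 (\<lambda>s. (letter_symbol a, 1))) ts 1 ?ts"
    by (rule runs_tape_act) (simp add: Cons.prems behind_append)
  from runs_Seq[OF this Cons.IH[of ?ts "u @ [a]", unfolded fun_upd_upd]] show ?case by simp
qed

lemma runs_erase_program:
  assumes "ts 0 = behind (map letter_symbol (u @ v))"
  shows "runs (erase_program (length v)) ts (4 * length v + 1) (ts(0 := behind (map letter_symbol u)))"
  using assms
proof (induction v arbitrary: ts rule: rev_induct)
  case Nil
  show ?case
    unfolding append_program.simps erase_program.simps list.size
    by (intro runs_mono[OF runs_tape_act]) (use Nil in simp_all)
next
  case (snoc a v)
  let ?w = "map letter_symbol (u @ v)"
  have 1: "runs (tape_act 0 (\<lambda>s. (s, -1))) ts 1 (ts(0 := shifted (behind (?w @ [letter_symbol a])) (-1)))"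
    by (rule runs_tape_act) (simp add: snoc.prems)
  have 2: "runs (tape_act 0 (\<lambda>s. (0, 0))) (ts(0 := shifted (behind (?w @ [letter_symbol a])) (-1))) 1
      (ts(0 := shifted (behind (?w @ [letter_symbol a])) (-1), 0 := behind ?w))"
    by (rule runs_tape_act) (simp only: fun_upd_same behind_erase)
  have 3: "runs (erase_program (length v)) (ts(0 := behind ?w)) (4 * length v + 1)
      (ts(0 := behind (map letter_symbol u)))"
    by (rule snoc.IH[of "ts(0 := behind ?w)", unfolded fun_upd_upd]) simp
  show ?case
    unfolding length_append_singleton erase_program.simps
    by (rule runs_mono[OF runs_Seq[OF 1 runs_Seq[OF 2[unfolded fun_upd_upd] 3]]]) simp
qed

text \<open>Shaped like the nested loops, so that their correctness is an induction over the list of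
  words.\<close>

fun reachable :: "(letter list \<Rightarrow> bool) \<Rightarrow> nat \<Rightarrow> letter list \<Rightarrow> letter list list \<Rightarrow> bool" where
  "reachable P n u [] \<longleftrightarrow> P u"
| "reachable P n u (v # vs) \<longleftrightarrow> (\<exists>i<n. reachable P n (u @ concat (replicate i v)) vs)"

text \<open>
  One nested loop for every word of the list; the loop variable of the first is the position on
  tape \<open>c\<close>, and so on.
\<close>

fun search_program :: "prog \<Rightarrow> nat \<Rightarrow> letter list list \<Rightarrow> prog" where
  "search_program p c [] = p"
| "search_program p c (v # vs) =
     Seq (tape_act c (\<lambda>s. (s, -1)))
    (Seq (While (\<lambda>r. r c \<noteq> 0)
       (Seq (search_program p (Suc c) vs) (Seq (append_program v) (tape_act c (\<lambda>s. (s, -1))))))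
    (Seq (tape_act c (\<lambda>s. (s, 1)))
    (While (\<lambda>r. r c \<noteq> 0) (Seq (erase_program (length v)) (tape_act c (\<lambda>s. (s, 1)))))))"

text \<open>Each of the \<open>n\<close> values of the loop variable pays for an inner search, one
  appending of \<open>v\<close> and, on the way back, one erasing of \<open>v\<close>. Every word
  thus contributes one factor \<open>n\<close>.\<close>

fun search_time :: "nat \<Rightarrow> nat \<Rightarrow> letter list list \<Rightarrow> nat" where
  "search_time t n [] = t"
| "search_time t n (v # vs) = n * (search_time t n vs + 6 * length v + 9) + 7"

lemma concat_replicate_snoc: "concat (replicate i v) @ v = concat (replicate (Suc i) v)"
  by (induction i) auto

text \<open>Only the flag differs at the end, which is what allows the inner search to be repeated
  in every pass of the outer loop. \<open>bound\<close> limits the words tested, so that a single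
  time \<open>t\<close> holds for all tests.\<close>

lemma runs_search_program:
  assumes p: "\<And>ts u x. ready k ts u x \<Longrightarrow> length u \<le> bound \<Longrightarrow>
       runs p ts t (ts(flag_tape k := cell (if P u then 1 else x)))"
    and "ready k ts u x" "flag_tape k < c"
    and "\<And>j. c \<le> j \<Longrightarrow> j < c + length vs \<Longrightarrow> ts j = bar (int n) 0"
    and "length u + n * sum_list (map length vs) \<le> bound"
  shows "runs (search_program p c vs) ts (search_time t n vs)
     (ts(flag_tape k := cell (if reachable P n u vs then 1 else x)))"
  using assms(2-)
proof (induction vs arbitrary: ts u x c)
  case Nil
  show ?case
    unfolding search_program.simps search_time.simps reachable.simps
    by (rule p) (use Nil in simp_all)
next
  case (Cons v vs)
  let ?u = "\<lambda>i. u @ concat (replicate i v)"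
  define hit where "hit i \<longleftrightarrow> (\<exists>i'<i. reachable P n (?u i') vs)" for i
  define f where "f i = cell (if hit i then 1 else x)" for i
  \<comment> \<open>\<open>\<sigma>\<close> walks left over the ones on tape \<open>c\<close> while
    copies of \<open>v\<close> are appended, \<open>\<tau>\<close> walks back over the same ones
    while they are removed. All \<open>n\<close> copies are appended, but the tests see only 0 to
    \<open>n - 1\<close> of them.\<close>
  define \<sigma> where "\<sigma> i = ts(0 := behind (map letter_symbol (?u i)),
     c := bar (int n - 1 - int i) (1 + int i), flag_tape k := f i)" for i
  define \<tau> where "\<tau> i = ts(0 := behind (map letter_symbol (?u (n - i))),
     c := bar (int i) (int n - int i), flag_tape k := f n)" for i
  have c: "c \<noteq> 0" "c \<noteq> flag_tape k" "flag_tape k \<noteq> 0" using Cons.prems(2) by auto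
  have tsc: "ts c = bar (int n) 0" using Cons.prems(3)[of c] by simp
  have ts0: "ts 0 = behind (map letter_symbol u)" and tsf: "ts (flag_tape k) = cell x"
    using Cons.prems(1) by (auto simp: ready_def)
  have "runs (search_program p c (v # vs)) ts
    (Suc (1 + Suc ((n * Suc (Suc (search_time t n vs + Suc ((2 * length v + 1) + 1))) + 1) +
       Suc (1 + (n * Suc (Suc ((4 * length v + 1) + 1)) + 1))))) (\<tau> n)"
    unfolding search_program.simps
  proof (intro runs_Seq)
    have "runs (tape_act c (\<lambda>s. (s, -1))) ts 1 (ts(c := bar (int n - 1) 1))"
      by (rule runs_tape_act) (simp add: tsc)
    moreover have "\<sigma> 0 = ts(c := bar (int n - 1) 1)"
      using c ts0 tsf by (auto simp: \<sigma>_def f_def hit_def)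
    ultimately show "runs (tape_act c (\<lambda>s. (s, -1))) ts 1 (\<sigma> 0)" by simp
    show "runs (While (\<lambda>r. r c \<noteq> 0) (Seq (search_program p (Suc c) vs)
        (Seq (append_program v) (tape_act c (\<lambda>s. (s, -1)))))) (\<sigma> 0)
        (n * Suc (Suc (search_time t n vs + Suc ((2 * length v + 1) + 1))) + 1) (\<sigma> n)"
    proof (rule runs_While)
      show "reads (\<sigma> j) c \<noteq> 0" if "j < n" for j
        using that c by (simp add: \<sigma>_def reads_def bar_apply_0)
      show "\<not> reads (\<sigma> n) c \<noteq> 0" using c by (simp add: \<sigma>_def reads_def bar_apply_0)
      show "runs (Seq (search_program p (Suc c) vs)
        (Seq (append_program v) (tape_act c (\<lambda>s. (s, -1))))) (\<sigma> j)
        (Suc (search_time t n vs + Suc ((2 * length v + 1) + 1))) (\<sigma> (Suc j))" if "j < n" for j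
      proof (intro runs_Seq)
        have "ready k (\<sigma> j) (?u j) (if hit j then 1 else x)"
          using Cons.prems(1,2) c by (auto simp: ready_def \<sigma>_def f_def)
        moreover have "\<sigma> j i = bar (int n) 0" if "Suc c \<le> i" "i < Suc c + length vs" for i
          using that Cons.prems(2) Cons.prems(3)[of i] by (auto simp: \<sigma>_def)
        moreover have "length (?u j) + n * sum_list (map length vs) \<le> bound"
        proof -
          have "length (?u j) = length u + j * length v" by (induction j) auto
          moreover have "j * length v \<le> n * length v" using that by simp
          moreover have "length u + n * length v + n * sum_list (map length vs) \<le> bound"
            using Cons.prems(4) by (simp add: algebra_simps)
          ultimately show ?thesis by linarith
        qed
        moreover have "flag_tape k < Suc c" using Cons.prems(2) by simp
        ultimately have "runs (search_program p (Suc c) vs) (\<sigma> j) (search_time t n vs)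
          ((\<sigma> j)(flag_tape k :=
             cell (if reachable P n (?u j) vs then 1 else (if hit j then 1 else x))))"
          by (intro Cons.IH) auto
        moreover have "hit (Suc j) \<longleftrightarrow> reachable P n (?u j) vs \<or> hit j"
          by (auto simp: hit_def less_Suc_eq)
        then have "f (Suc j) = cell (if reachable P n (?u j) vs then 1 else (if hit j then 1 else x))"
          by (simp add: f_def)
        ultimately show "runs (search_program p (Suc c) vs) (\<sigma> j) (search_time t n vs)
          ((\<sigma> j)(flag_tape k := f (Suc j)))"
          by (simp only:)
        have "runs (append_program v) ((\<sigma> j)(flag_tape k := f (Suc j))) (2 * length v + 1)
          ((\<sigma> j)(flag_tape k := f (Suc j), 0 := behind (map letter_symbol (?u j @ v))))"
          by (rule runs_append_program) (use c in \<open>simp add: \<sigma>_def\<close>)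
        then show "runs (append_program v) ((\<sigma> j)(flag_tape k := f (Suc j))) (2 * length v + 1)
          ((\<sigma> j)(flag_tape k := f (Suc j), 0 := behind (map letter_symbol (?u (Suc j)))))"
          by (simp only: append_assoc concat_replicate_snoc)
        have "(\<sigma> j)(flag_tape k := f (Suc j), 0 := behind (map letter_symbol (?u (Suc j))),
            c := bar (int n - 1 - int (Suc j)) (1 + int (Suc j))) = \<sigma> (Suc j)"
          using c by (auto simp: \<sigma>_def)
        moreover have "runs (tape_act c (\<lambda>s. (s, -1)))
          ((\<sigma> j)(flag_tape k := f (Suc j), 0 := behind (map letter_symbol (?u (Suc j))))) 1
          ((\<sigma> j)(flag_tape k := f (Suc j), 0 := behind (map letter_symbol (?u (Suc j))),
            c := bar (int n - 1 - int (Suc j)) (1 + int (Suc j))))"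
          by (rule runs_tape_act) (use c in \<open>simp add: \<sigma>_def algebra_simps\<close>)
        ultimately show "runs (tape_act c (\<lambda>s. (s, -1)))
          ((\<sigma> j)(flag_tape k := f (Suc j), 0 := behind (map letter_symbol (?u (Suc j))))) 1 (\<sigma> (Suc j))"
          by simp
      qed
    qed
    have "(\<sigma> n)(c := bar 0 (int n)) = \<tau> 0" using c by (auto simp: \<sigma>_def \<tau>_def)
    moreover have "runs (tape_act c (\<lambda>s. (s, 1))) (\<sigma> n) 1 ((\<sigma> n)(c := bar 0 (int n)))"
      by (rule runs_tape_act) (use c in \<open>simp add: \<sigma>_def\<close>)
    ultimately show "runs (tape_act c (\<lambda>s. (s, 1))) (\<sigma> n) 1 (\<tau> 0)" by simp
    show "runs (While (\<lambda>r. r c \<noteq> 0) (Seq (erase_program (length v)) (tape_act c (\<lambda>s. (s, 1)))))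
        (\<tau> 0) (n * Suc (Suc ((4 * length v + 1) + 1)) + 1) (\<tau> n)"
    proof (rule runs_While)
      show "reads (\<tau> j) c \<noteq> 0" if "j < n" for j
        using that c by (simp add: \<tau>_def reads_def bar_apply_0)
      show "\<not> reads (\<tau> n) c \<noteq> 0" using c by (simp add: \<tau>_def reads_def bar_apply_0)
      show "runs (Seq (erase_program (length v)) (tape_act c (\<lambda>s. (s, 1)))) (\<tau> j)
        (Suc ((4 * length v + 1) + 1)) (\<tau> (Suc j))" if "j < n" for j
      proof (intro runs_Seq)
        have "?u (n - j) = ?u (n - Suc j) @ v"
          using that by (simp add: concat_replicate_snoc Suc_diff_Suc del: replicate_Suc)
        then show "runs (erase_program (length v)) (\<tau> j) (4 * length v + 1)
          ((\<tau> j)(0 := behind (map letter_symbol (?u (n - Suc j)))))"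
          by (intro runs_erase_program) (use c in \<open>simp add: \<tau>_def\<close>)
        have "(\<tau> j)(0 := behind (map letter_symbol (?u (n - Suc j))),
            c := bar (int (Suc j)) (int n - int (Suc j))) = \<tau> (Suc j)"
          using c by (auto simp: \<tau>_def)
        moreover have "runs (tape_act c (\<lambda>s. (s, 1)))
          ((\<tau> j)(0 := behind (map letter_symbol (?u (n - Suc j))))) 1
          ((\<tau> j)(0 := behind (map letter_symbol (?u (n - Suc j))),
            c := bar (int (Suc j)) (int n - int (Suc j))))"
          by (rule runs_tape_act) (use c in \<open>simp add: \<tau>_def algebra_simps\<close>)
        ultimately show "runs (tape_act c (\<lambda>s. (s, 1)))
          ((\<tau> j)(0 := behind (map letter_symbol (?u (n - Suc j))))) 1 (\<tau> (Suc j))"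
          by simp
      qed
    qed
  qed
  then have "runs (search_program p c (v # vs)) ts (search_time t n (v # vs)) (\<tau> n)"
    by (rule runs_mono) (simp add: algebra_simps)
  moreover have "\<tau> n = ts(flag_tape k := cell (if reachable P n u (v # vs) then 1 else x))"
    using c ts0 tsc by (auto simp: \<tau>_def f_def hit_def)
  ultimately show ?case by (simp only:)
qed

section \<open>Preparing the tapes in one sweep over the input\<close>

text \<open>
  While sweeping over the input, a finite automaton runs on tape \<open>flag_tape k + 1\<close>, and every
  loop tape receives the length of the input in unary.
\<close>

definition sweep :: "nat \<Rightarrow> nat \<Rightarrow> (nat \<Rightarrow> nat \<Rightarrow> nat) \<Rightarrow> (nat \<Rightarrow> nat) \<Rightarrow> nat \<Rightarrow> nat \<times> int" where
  "sweep k K \<delta> r i =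
     (if i = 0 then (r 0, 1) else if i = k + 4 then (\<delta> (r (k + 4)) (r 0), 0)
      else if k + 4 < i \<and> i < K then (1, 1) else (r i, 0))"

definition prepare_program :: "nat \<Rightarrow> nat \<Rightarrow> (nat \<Rightarrow> nat \<Rightarrow> nat) \<Rightarrow> prog" where
  "prepare_program k K \<delta> =
     Seq (While (\<lambda>r. r 0 \<noteq> 0) (Act (sweep k K \<delta>))) (tape_act 0 (\<lambda>s. (letter_symbol Open, 1)))"

text \<open>The automaton starts in state 0 because its tape is blank. The appended
  \<open>Open\<close> begins the list of the coalition's votes; its partner is supplied by
  \<open>wrapped\<close>.\<close>

definition prepared ::
    "nat \<Rightarrow> nat \<Rightarrow> (nat \<Rightarrow> nat \<Rightarrow> nat) \<Rightarrow> letter list \<Rightarrow> nat \<Rightarrow> view" where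
  "prepared k K \<delta> w =
     (\<lambda>i. if i = 0 then behind (map letter_symbol (w @ [Open]))
          else if i = k + 4 then cell (foldl \<delta> 0 (map letter_symbol w))
          else if k + 4 < i \<and> i < K then bar (int (length w)) 0 else blank)"

lemma runs_prepare_program:
  shows "runs (prepare_program k K \<delta>) ((\<lambda>_. blank)(0 := ahead (map letter_symbol w)))
     (2 * length w + 3) (prepared k K \<delta> w)"
proof -
  let ?w = "map letter_symbol w" and ?n = "length w"
  define \<sigma> where "\<sigma> i = (\<lambda>j. if j = 0 then shifted (ahead ?w) (int i)
    else if j = k + 4 then cell (foldl \<delta> 0 (take i ?w))
    else if k + 4 < j \<and> j < K then bar (int i) 0 else blank)" for i
  have "runs (prepare_program k K \<delta>) (\<sigma> 0) (Suc ((?n * Suc 1 + 1) + 1)) (prepared k K \<delta> w)"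
    unfolding prepare_program_def
  proof (rule runs_Seq)
    show "runs (While (\<lambda>r. r 0 \<noteq> 0) (Act (sweep k K \<delta>))) (\<sigma> 0) (?n * Suc 1 + 1) (\<sigma> ?n)"
    proof (rule runs_While)
      have at: "ahead ?w (int j) = letter_symbol (w ! j)" if "j < ?n" for j
        using that by (simp add: ahead_def)
      show "reads (\<sigma> j) 0 \<noteq> 0" if "j < ?n" for j
        using that by (simp add: \<sigma>_def reads_def at)
      show "\<not> reads (\<sigma> ?n) 0 \<noteq> 0" by (simp add: \<sigma>_def reads_def ahead_def)
      show "runs (Act (sweep k K \<delta>)) (\<sigma> j) 1 (\<sigma> (Suc j))" if "j < ?n" for j
      proof (rule runs_Act, rule ext)
        fix i
        have "act_view (bar (int j) 0) (1, 1) = bar (int (Suc j)) 0"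
          using bar_extend[of "int j"] by (simp add: add.commute)
        then show "perform (\<sigma> j) (sweep k K \<delta> (reads (\<sigma> j))) i = \<sigma> (Suc j) i"
          using that by (auto simp: perform_def sweep_def \<sigma>_def reads_def at take_Suc_conv_app_nth
            add.commute cell_0)
      qed
    qed
    have "behind (?w @ [letter_symbol Open]) = act_view (behind ?w) (letter_symbol Open, 1)"
      by (rule behind_append[symmetric])
    then have "prepared k K \<delta> w = (\<sigma> ?n)(0 := act_view (\<sigma> ?n 0) (letter_symbol Open, 1))"
      by (auto simp: prepared_def \<sigma>_def fun_eq_iff behind_def simp del: letter_symbol.simps)
    moreover have "runs (tape_act 0 (\<lambda>s. (letter_symbol Open, 1))) (\<sigma> ?n) 1
        ((\<sigma> ?n)(0 := act_view (\<sigma> ?n 0) (letter_symbol Open, 1)))"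
      by (rule runs_tape_act) simp
    ultimately show "runs (tape_act 0 (\<lambda>s. (letter_symbol Open, 1))) (\<sigma> ?n) 1 (prepared k K \<delta> w)"
      by simp
  qed
  moreover have "\<sigma> 0 = (\<lambda>_. blank)(0 := ahead ?w)"
    by (auto simp: \<sigma>_def cell_0 bar_blank)
  ultimately show ?thesis by (auto elim!: runs_mono)
qed

section \<open>Safety of the programs\<close>

lemma safe_act:
  assumes K: "k + 4 \<le> K"
    and "\<And>r. (\<And>i. r i \<in> \<Gamma>) \<Longrightarrow>
       {B r, Q r, C r, F r} \<subseteq> \<Gamma> \<times> {-1, 0, 1} \<and> (\<forall>i. 1 \<le> i \<longrightarrow> i \<le> k \<longrightarrow> W r i \<in> \<Gamma> \<times> {-1, 0, 1})"
  shows "safe K \<Gamma> (act k B W Q C F)"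
  unfolding act_def safe.simps safe_act_def
proof (intro allI impI conjI)
  fix r :: "nat \<Rightarrow> nat" and i
  assume "\<forall>i\<ge>K. r i = 0" "K \<le> i"
  then show "layout k (B r) (W r) (Q r) (C r) (F r) (\<lambda>i. (r i, 0)) i = (0, 0)"
    using K by (simp add: layout_def)
next
  fix r :: "nat \<Rightarrow> nat" and i
  assume "\<forall>i. r i \<in> \<Gamma>"
  then show "layout k (B r) (W r) (Q r) (C r) (F r) (\<lambda>i. (r i, 0)) i \<in> \<Gamma> \<times> {-1, 0, 1}"
    using assms(2)[of r] by (auto simp: layout_def)
qed

lemma safe_tape_act:
  assumes "i < K" "\<And>s. s \<in> \<Gamma> \<Longrightarrow> a s \<in> \<Gamma> \<times> {-1, 0, 1}"
  shows "safe K \<Gamma> (tape_act i a)"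
  using assms unfolding tape_act_def safe.simps safe_act_def by auto

lemma safe_append_program:
  assumes "0 < K" "range letter_symbol \<subseteq> \<Gamma>"
  shows "safe K \<Gamma> (append_program v)"
  using assms by (induction v) (auto intro!: safe_tape_act)

lemma safe_erase_program:
  assumes "0 < K" "0 \<in> \<Gamma>"
  shows "safe K \<Gamma> (erase_program n)"
  using assms by (induction n) (auto intro!: safe_tape_act)

lemma safe_search_program:
  assumes "safe K \<Gamma> p" "insert 0 (range letter_symbol) \<subseteq> \<Gamma>" "c + length vs \<le> K"
  shows "safe K \<Gamma> (search_program p c vs)"
  using assms(3)
proof (induction vs arbitrary: c)
  case (Cons v vs)
  then show ?case
    using assms(2) by (auto intro!: safe_tape_act safe_append_program safe_erase_program)
qed (use assms in simp)

lemma safe_prepare_program: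
  assumes "range letter_symbol \<subseteq> \<Gamma>" "1 \<in> \<Gamma>" "k + 5 \<le> K" "\<And>q s. \<delta> q s \<in> \<Gamma>"
  shows "safe K \<Gamma> (prepare_program k K \<delta>)"
  using assms unfolding prepare_program_def
  by (auto intro!: safe_tape_act simp: safe_act_def sweep_def simp del: letter_symbol.simps)

text \<open>\<open>turing_machine\<close> restricts \<open>trans\<close> only on the machine's own
  states and symbols, but \<open>safe\<close> asks about all readings from a larger alphabet. The
  idle branch of \<open>machine_move\<close> answers the remaining ones.\<close>

lemma machine_move_within:
  assumes M: "turing_machine M" and \<Gamma>: "states M \<union> symbols M \<subseteq> \<Gamma>" "\<And>i. r i \<in> \<Gamma>"
  shows "fst (machine_move M r) \<in> \<Gamma> \<and>
    (\<forall>i. 1 \<le> i \<longrightarrow> i \<le> tape_count M \<longrightarrow> snd (machine_move M r) ! (i - 1) \<in> \<Gamma> \<times> {-1, 0, 1})"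
proof -
  let ?ss = "map r [1..<Suc (tape_count M)]"
  show ?thesis
  proof (cases "r (state_tape (tape_count M)) \<in> states M \<and> set ?ss \<subseteq> symbols M")
    case True
    then have mv: "machine_move M r = trans M (r (state_tape (tape_count M))) ?ss"
      by (simp add: machine_move_def Let_def del: upt_Suc)
    have "length ?ss = tape_count M" by simp
    from turing_machine_trans[OF M _ this, of "r (state_tape (tape_count M))"
        "fst (machine_move M r)" "snd (machine_move M r)"] True mv
    have t: "fst (machine_move M r) \<in> states M" "length (snd (machine_move M r)) = tape_count M"
      "set (snd (machine_move M r)) \<subseteq> symbols M \<times> {-1, 0, 1}" by simp_all
    have "snd (machine_move M r) ! (i - 1) \<in> \<Gamma> \<times> {-1, 0, 1}" if "1 \<le> i" "i \<le> tape_count M" for i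
    proof -
      have "snd (machine_move M r) ! (i - 1) \<in> set (snd (machine_move M r))"
        using that t(2) by (intro nth_mem) simp
      then have "snd (machine_move M r) ! (i - 1) \<in> symbols M \<times> {-1, 0, 1}"
        using t(3) by (rule rev_subsetD)
      then show ?thesis using \<Gamma>(1) by (auto simp: mem_Times_iff)
    qed
    then show ?thesis using t(1) \<Gamma>(1) by auto
  next
    case False
    then have "machine_move M r = (r (state_tape (tape_count M)), map (\<lambda>s. (s, 0)) ?ss)"
      unfolding machine_move_def Let_def by (simp only: if_False)
    then show ?thesis using \<Gamma>(2) by (auto simp del: upt_Suc)
  qed
qed

lemma safe_test_program:
  assumes M: "turing_machine M" and K: "tape_count M + 4 \<le> K"
    and \<Gamma>: "states M \<union> symbols M \<subseteq> \<Gamma>" "{0, 1, 4, 5} \<subseteq> \<Gamma>"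
  shows "safe K \<Gamma> (test_program M)"
proof -
  have "start M \<in> \<Gamma>" using M \<Gamma>(1) by (auto simp: turing_machine_def)
  then show ?thesis
    unfolding test_program_def copy_program_def simulation_program_def clean_program_def Let_def
      safe.simps
    by (intro conjI safe_act K) (use \<Gamma> machine_move_within[OF M \<Gamma>(1)] in \<open>auto simp: act_simps\<close>)
qed

section \<open>Polynomial bounds\<close>

definition poly_bounded :: "(nat \<Rightarrow> nat) \<Rightarrow> bool" where
  "poly_bounded f \<longleftrightarrow> (\<exists>p. \<forall>n. f n \<le> poly p n)"

lemma poly_bounded_const: "poly_bounded (\<lambda>_. c)"
  unfolding poly_bounded_def by (rule exI[of _ "[:c:]"]) simp

lemma poly_bounded_id: "poly_bounded (\<lambda>n. n)"
  unfolding poly_bounded_def by (rule exI[of _ "[:0, 1:]"]) simp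

lemma poly_bounded_add: "poly_bounded f \<Longrightarrow> poly_bounded g \<Longrightarrow> poly_bounded (\<lambda>n. f n + g n)"
  unfolding poly_bounded_def by (metis add_mono poly_add)

lemma poly_bounded_mult: "poly_bounded f \<Longrightarrow> poly_bounded g \<Longrightarrow> poly_bounded (\<lambda>n. f n * g n)"
  unfolding poly_bounded_def by (metis mult_le_mono poly_mult)

text \<open>Natural coefficients allow no cancellation.\<close>

lemma poly_mono_nat: "a \<le> b \<Longrightarrow> poly p a \<le> poly p b" for p :: "nat poly"
  by (induction p) (auto intro: add_mono mult_le_mono)

lemma poly_bounded_poly: "poly_bounded f \<Longrightarrow> poly_bounded (\<lambda>n. poly p (f n))"
  unfolding poly_bounded_def by (metis poly_mono_nat poly_pcompose)

lemmas poly_bounded_intros =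
  poly_bounded_const poly_bounded_id poly_bounded_add poly_bounded_mult poly_bounded_poly

lemma poly_bounded_search_time:
  "poly_bounded t \<Longrightarrow> poly_bounded (\<lambda>n. search_time (t n) n vs)"
  by (induction vs) (auto intro!: poly_bounded_intros)

lemma poly_bounded_test_time: "poly_bounded f \<Longrightarrow> poly_bounded (\<lambda>n. test_time p (f n))"
  unfolding test_time_def by (intro poly_bounded_intros)

lemma test_time_mono: "a \<le> b \<Longrightarrow> test_time p a \<le> test_time p b"
  unfolding test_time_def by (intro add_mono mult_le_mono poly_mono_nat) auto

text \<open>\<open>F\<close> selects the accepting states of the automaton. The bound
  \<open>D\<close> makes its states part of a finite alphabet, since they are written on a tape; the
  states of the given machine enter \<open>\<Gamma>\<close> likewise.\<close>

lemma PTIME_reachable: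
  assumes E: "E \<in> PTIME" and \<delta>: "\<And>q s. \<delta> q s \<le> (D::nat)"
  shows "{w. F (foldl \<delta> 0 (map letter_symbol w)) \<and>
     reachable (\<lambda>u. wrapped u \<in> E) (length w) (w @ [Open]) vs} \<in> PTIME" (is "?A \<in> _")
proof -
  obtain M p where M: "turing_machine M" and dec: "decides_in_time M E (poly p)"
    using E by (auto simp: PTIME_def)
  define k where "k = tape_count M"
  \<comment> \<open>Tape 0, the \<open>k\<close> tapes of the given machine, its state, clock and
    flag, the automaton, and one tape per loop.\<close>
  define K where "K = k + 5 + length vs"
  define \<Gamma> where "\<Gamma> = states M \<union> symbols M \<union> {..D} \<union> {0, 1} \<union> range letter_symbol"
  define P where "P = Seq (prepare_program k K \<delta>) (search_program (test_program M) (k + 5) vs)"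
  define acc where "acc r \<longleftrightarrow> r (flag_tape k) = 1 \<and> F (r (k + 4))" for r :: "nat \<Rightarrow> nat"
  \<comment> \<open>Bounds the words tested: the input, one \<open>Open\<close>, and at most
    \<open>n\<close> copies of each word of \<open>vs\<close>. In \<open>T\<close>, the final 2 is
    one step that unfolds \<open>Seq\<close> and one that gives the verdict.\<close>
  define bound where "bound n = n + 1 + n * sum_list (map length vs)" for n
  define T where "T n = (2 * n + 3) + search_time (test_time p (bound n)) n vs + 2" for n
  have letters: "range letter_symbol = {1, 2, 3, 4, 5}"
  proof -
    have all: "(UNIV :: letter set) = {Zero, One, End, Open, Close}" using letter.exhaust by blast
    show ?thesis unfolding all by simp
  qed
  have fin: "finite \<Gamma>" using M unfolding \<Gamma>_def letters by (simp add: turing_machine_def)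
  have safe: "safe K \<Gamma> P"
    unfolding P_def safe.simps
  proof
    show "safe K \<Gamma> (prepare_program k K \<delta>)"
      by (rule safe_prepare_program) (use \<delta> in \<open>auto simp: \<Gamma>_def K_def\<close>)
    show "safe K \<Gamma> (search_program (test_program M) (k + 5) vs)"
    proof (rule safe_search_program)
      show "safe K \<Gamma> (test_program M)"
        by (rule safe_test_program[OF M])
          (use letters in \<open>auto simp: \<Gamma>_def K_def k_def\<close>)
    qed (auto simp: \<Gamma>_def K_def)
  qed
  have "turing_machine (compile K \<Gamma> P acc)"
    by (rule turing_machine_compile[OF safe fin]) (auto simp: K_def \<Gamma>_def)
  moreover have "\<exists>q. decides_in_time (compile K \<Gamma> P acc) ?A (poly q)"
  proof -
    have "poly_bounded T"
      unfolding T_def bound_def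
      by (intro poly_bounded_intros poly_bounded_search_time poly_bounded_test_time)
    then obtain q where q: "\<And>n. T n \<le> poly q n" by (auto simp: poly_bounded_def)
    have "\<exists>t \<le> poly q (length w). fst ((step (compile K \<Gamma> P acc) ^^ t) (initial (compile K \<Gamma> P acc) w)) =
        (if w \<in> ?A then 0 else 1)" for w
    proof -
      define ts where "ts = (\<lambda>_::nat. blank)(0 := ahead (map letter_symbol w))"
      define ts' where "ts' = prepared k K \<delta> w"
      define found where "found \<longleftrightarrow> reachable (\<lambda>u. wrapped u \<in> E) (length w) (w @ [Open]) vs"
      let ?t = "test_time p (bound (length w))"
      let ?end = "ts'(flag_tape k := cell (if found then 1 else 0))"
      have "runs (search_program (test_program M) (k + 5) vs) ts' (search_time ?t (length w) vs) ?end"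
        unfolding found_def
      proof (rule runs_search_program)
        show "runs (test_program M) ts ?t (ts(flag_tape k := cell (if wrapped u \<in> E then 1 else x)))"
          if "ready k ts u x" "length u \<le> bound (length w)" for ts u x
          unfolding k_def
          by (rule runs_mono[OF runs_test_program[OF M dec]])
            (use that in \<open>auto simp: k_def intro: test_time_mono\<close>)
        show "ready k ts' (w @ [Open]) 0"
          by (auto simp: ready_def ts'_def prepared_def cell_0)
        show "ts' j = bar (int (length w)) 0" if "k + 5 \<le> j" "j < k + 5 + length vs" for j
          using that by (auto simp: ts'_def prepared_def K_def)
        show "length (w @ [Open]) + length w * sum_list (map length vs) \<le> bound (length w)"
          by (simp add: bound_def)
      qed simp
      from runs_Seq[OF runs_prepare_program[of k K \<delta> w, folded ts_def ts'_def] this]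
      have run: "runs P ts (Suc (2 * length w + 3 + search_time ?t (length w) vs)) ?end"
        unfolding P_def .
      let ?tapes = "word_tape w # replicate (K - 1) blank_tape"
      have "map view ?tapes = map ts [0..<K]"
        by (rule nth_equalityI)
          (auto simp: ts_def K_def nth_Cons' view_word_tape view_blank_tape)
      moreover have "\<forall>i\<ge>K. ts i = blank" by (auto simp: ts_def K_def)
      ultimately obtain t where t: "t \<le> Suc (Suc (2 * length w + 3 + search_time ?t (length w) vs))"
        "fst ((step (compile K \<Gamma> P acc) ^^ t) (stack_number P [P] + 2, ?tapes)) =
           (if acc (reads ?end) then 0 else 1)"
        using compile_halts[OF safe _ _ run, of ?tapes acc] by blast
      have "acc (reads ?end) \<longleftrightarrow> w \<in> ?A"
        by (auto simp: acc_def reads_def found_def ts'_def prepared_def)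
      moreover have "initial (compile K \<Gamma> P acc) w = (stack_number P [P] + 2, ?tapes)"
        by (simp add: initial_def compile_def)
      moreover have "t \<le> poly q (length w)"
        using t(1) q[of "length w"] by (simp add: T_def)
      ultimately show ?thesis using t(2) by auto
    qed
    moreover have "accept (compile K \<Gamma> P acc) = 0" "reject (compile K \<Gamma> P acc) = 1"
      by (simp_all add: compile_def)
    ultimately have "decides_in_time (compile K \<Gamma> P acc) ?A (poly q)"
      unfolding decides_in_time_def by (simp only:) blast
    then show ?thesis by blast
  qed
  ultimately show ?thesis unfolding PTIME_def by blast
qed

section \<open>Encodings\<close>

fun level :: "letter list \<Rightarrow> int" where
  "level [] = 0"
| "level (a # w) = (case a of Open \<Rightarrow> - 1 | Close \<Rightarrow> 1 | _ \<Rightarrow> 0) + level w"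

lemma level_append [simp]: "level (u @ v) = level u + level v"
  by (induction u) auto

text \<open>Closing brackets count positively, since words are scanned from the right; hence the
  condition on suffixes.\<close>

definition balanced :: "letter list \<Rightarrow> bool" where
  "balanced w \<longleftrightarrow> level w = 0 \<and> (\<forall>p s. w = p @ s \<longrightarrow> 0 \<le> level s)"

lemma balanced_append:
  assumes "balanced u" "balanced v"
  shows "balanced (u @ v)"
  unfolding balanced_def
proof (intro conjI allI impI)
  show "level (u @ v) = 0" using assms by (simp add: balanced_def)
  fix p s
  assume "u @ v = p @ s"
  then consider w where "u = p @ w" "s = w @ v" | w where "v = w @ s"
    by (auto simp: append_eq_append_conv2)
  then show "0 \<le> level s" using assms unfolding balanced_def by cases auto
qed

lemma balanced_concat: "\<forall>w \<in> set ws. balanced w \<Longrightarrow> balanced (concat ws)"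
proof (induction ws)
  case Nil
  then show ?case by (simp add: balanced_def)
next
  case (Cons w ws)
  then show ?case by (simp add: balanced_append)
qed

text \<open>Such a suffix contains the last \<open>Close\<close> but not the first
  \<open>Open\<close>, its partner.\<close>

lemma level_proper_suffix:
  assumes "balanced w" "Open # w @ [Close] = p @ s" "p \<noteq> []" "s \<noteq> []"
  shows "1 \<le> level s"
proof -
  obtain p' where "p = Open # p'" "w @ [Close] = p' @ s"
    using assms(2,3) by (cases p) auto
  moreover obtain s' where s': "s = s' @ [Close]"
    using calculation(2) assms(4) by (metis append_butlast_last_id last_appendR last_snoc)
  ultimately have "w = p' @ s'" by simp
  then show ?thesis using assms(1) s' by (simp add: balanced_def)
qed

lemma balanced_serialize: "balanced (serialize c)"
proof (induction c)
  case (Bits bs)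
  have "level s = 0" if "map (\<lambda>b. if b then One else Zero) bs @ [End] = p @ s" for p s
  proof -
    have "set s \<subseteq> {Zero, One, End}"
      using arg_cong[OF that, of set] by (auto split: if_splits)
    then show ?thesis by (induction s) auto
  qed
  then show ?case unfolding balanced_def by (metis append_Nil order_refl serialize.simps(1))
next
  case (Group cs)
  let ?w = "concat (map serialize cs)"
  have b: "balanced ?w" using Group by (intro balanced_concat) auto
  have "0 \<le> level s" if "Open # ?w @ [Close] = p @ s" for p s
  proof (cases "p = [] \<or> s = []")
    case True
    then show ?thesis using that b by (auto simp: balanced_def dest: arg_cong[of _ _ level])
  next
    case False
    then show ?thesis using level_proper_suffix[OF b that] by simp
  qed
  then show ?case using b by (auto simp: balanced_def)
qed

text \<open>The last group of a word is found by matching brackets from the right.\<close>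

lemma serialize_Group_suffix_unique:
  assumes "u @ serialize (Group a) = v @ serialize (Group b)"
  shows "u = v"
proof -
  have no: "w = []" if "w @ serialize (Group a) = serialize (Group b)" for w a b
  proof (rule ccontr)
    assume "w \<noteq> []"
    moreover have "balanced (concat (map serialize b))"
      by (rule balanced_concat) (auto simp: balanced_serialize)
    ultimately have "1 \<le> level (serialize (Group a))"
      using that by (intro level_proper_suffix[of _ w]) auto
    then show False using balanced_serialize[of "Group a"] by (simp only: balanced_def)
  qed
  from assms obtain w where
    "u = v @ w \<and> w @ serialize (Group a) = serialize (Group b) \<or>
     u @ w = v \<and> serialize (Group a) = w @ serialize (Group b)"
    unfolding append_eq_append_conv2 by blast
  then show ?thesis using no by (metis append_Nil2)
qed

text \<open>Every weight costs at least its terminator, even weight 0, which has no digits. So the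
  input length is a strict bound on all multiplicities in a coalition profile.\<close>

lemma length_serialize_instance: "length (coalition_weights x) < length (serialize (instance_code x))"
proof -
  have "length ns \<le> length (concat (map (serialize \<circ> nat_code) ns))" for ns
    by (induction ns) (auto simp: nat_code_def)
  from this[of "coalition_weights x"] show ?thesis by (simp add: instance_code_def)
qed

text \<open>Both restrictions concern only the two leading lists, so the automata have their verdict
  before they reach \<open>r\<close>.\<close>

lemma serialize_instance:
  obtains r where "serialize (instance_code x) =
    Open # Open # concat (map (serialize \<circ> nat_code) (coalition_weights x)) @ Close #
    Open # concat (map (serialize \<circ> nat_code) (other_weights x)) @ Close # r"
  by (simp add: instance_code_def)

lemma binary_eq_True_iff: "binary n = [True] \<longleftrightarrow> n = 1"
proof
  assume a: "binary n = [True]"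
  then have "binary (n div 2) = [] \<and> odd n"
    by (subst (asm) binary.simps) (auto split: if_splits)
  moreover have "n div 2 = 0"
    using calculation by (subst (asm) binary.simps) (auto split: if_splits)
  ultimately show "n = 1" by (auto elim!: oddE)
qed (simp add: binary.simps)

section \<open>Finite automata for the two restrictions\<close>

text \<open>
  The two automata read values of \<^const>\<open>letter_symbol\<close>. The first accepts in state 4, its sink
  of rejection is 5; for the second these are 7 and 8.
\<close>

definition single_step :: "nat \<Rightarrow> nat \<Rightarrow> nat" where
  "single_step q s =
     (if q = 0 \<and> s = 4 then 1 else if q = 1 \<and> s = 4 then 2
      else if q = 2 \<and> s \<in> {1, 2} then 2 else if q = 2 \<and> s = 3 then 3
      else if q = 3 \<and> s = 5 then 4 else if q = 4 then 4 else 5)"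

lemma single_step_sink: "q \<in> {4, 5} \<Longrightarrow> foldl single_step q ss = q"
  by (induction ss) (auto simp: single_step_def)

lemma single_step_nat_code: "foldl single_step 2 (map letter_symbol (serialize (nat_code n))) = 3"
proof -
  have "foldl single_step 2 (map letter_symbol (map (\<lambda>b. if b then One else Zero) bs)) = 2" for bs
    by (induction bs) (auto simp: single_step_def)
  then show ?thesis by (simp add: nat_code_def) (simp add: single_step_def)
qed

text \<open>A further number begins with a digit or \<open>End\<close>, while state 3 tolerates only
  \<open>Close\<close>.\<close>

lemma single_step_reject: "foldl single_step 3 (map letter_symbol (serialize (nat_code n) @ w)) = 5"
proof -
  obtain a v where "serialize (nat_code n) = a # v" "a \<in> {Zero, One, End}"
    by (cases "binary n") (auto simp: nat_code_def)
  then have "foldl single_step 3 (map letter_symbol (serialize (nat_code n) @ w)) =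
      foldl single_step 5 (map letter_symbol (v @ w))"
    by (auto simp: single_step_def)
  then show ?thesis using single_step_sink[of 5] by simp
qed

lemma single_step_instance:
  "foldl single_step 0 (map letter_symbol (serialize (instance_code x))) = 4 \<longleftrightarrow> single_manipulator x"
proof -
  obtain r where r: "serialize (instance_code x) =
    Open # Open # concat (map (serialize \<circ> nat_code) (coalition_weights x)) @ Close # r"
    using serialize_instance[of x] by metis
  have start: "foldl single_step 0 (map letter_symbol (Open # Open # w)) =
      foldl single_step 2 (map letter_symbol w)" for w
    by (simp add: single_step_def)
  show ?thesis
  proof (cases "coalition_weights x")
    case Nil
    then have "foldl single_step 0 (map letter_symbol (serialize (instance_code x))) =
       foldl single_step 5 (map letter_symbol r)"
      unfolding r start by (simp add: single_step_def)
    then show ?thesis using single_step_sink[of 5] Nil by (simp add: single_manipulator_def)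
  next
    case (Cons n ns)
    have e: "foldl single_step 0 (map letter_symbol (serialize (instance_code x))) =
       foldl single_step 3 (map letter_symbol (concat (map (serialize \<circ> nat_code) ns) @ Close # r))"
      unfolding r start by (simp add: Cons single_step_nat_code)
    show ?thesis
    proof (cases ns)
      case Nil
      then have "foldl single_step 0 (map letter_symbol (serialize (instance_code x))) =
         foldl single_step 4 (map letter_symbol r)"
        unfolding e by (simp add: single_step_def)
      then show ?thesis using single_step_sink[of 4] Nil Cons by (simp add: single_manipulator_def)
    next
      case (Cons n' ns')
      then show ?thesis
        using \<open>coalition_weights x = n # ns\<close>
          single_step_reject[of n' "concat (map (serialize \<circ> nat_code) ns') @ Close # r"]
        unfolding e by (simp add: single_manipulator_def)
    qed
  qed
qed

text \<open>Two copies of a loop that reads \<open>[One, End]\<close>, the code of 1: states 2 and 3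
  for the coalition's weights, 5 and 6 for the other weights.\<close>

definition unit_step :: "nat \<Rightarrow> nat \<Rightarrow> nat" where
  "unit_step q s =
     (if q = 0 \<and> s = 4 then 1 else if q = 1 \<and> s = 4 then 2
      else if q = 2 \<and> s = 2 then 3 else if q = 3 \<and> s = 3 then 2
      else if q = 2 \<and> s = 5 then 4 else if q = 4 \<and> s = 4 then 5
      else if q = 5 \<and> s = 2 then 6 else if q = 6 \<and> s = 3 then 5
      else if q = 5 \<and> s = 5 then 7 else if q = 7 then 7 else 8)"

lemma unit_step_sink: "q \<in> {7, 8} \<Longrightarrow> foldl unit_step q ss = q"
  by (induction ss) (auto simp: unit_step_def)

lemma unit_step_nat_code:
  assumes q: "q \<in> {2, 5}"
  shows "foldl unit_step q (map letter_symbol (serialize (nat_code n))) = (if n = 1 then q else 8)"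
proof -
  have sink: "foldl unit_step 8 ss = 8" for ss by (simp add: unit_step_sink)
  have "foldl unit_step q (map letter_symbol (serialize (Bits bs))) = (if bs = [True] then q else 8)" for bs
  proof (cases bs)
    case Nil
    then show ?thesis using q by (auto simp: unit_step_def)
  next
    case (Cons b bs')
    show ?thesis
    proof (cases bs')
      case Nil
      then show ?thesis using q Cons by (auto simp: unit_step_def)
    next
      case (Cons b' bs'')
      have "unit_step (unit_step q (letter_symbol (if b then One else Zero)))
          (letter_symbol (if b' then One else Zero)) = 8"
        using q by (auto simp: unit_step_def)
      then show ?thesis using \<open>bs = b # bs'\<close> Cons sink sink[of "[3]"] by simp
    qed
  qed
  then show ?thesis by (simp only: nat_code_def binary_eq_True_iff)
qed

lemma unit_step_nat_codes:
  assumes q: "q \<in> {2, 5}"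
  shows "foldl unit_step q (map letter_symbol (concat (map (serialize \<circ> nat_code) ns))) =
    (if \<forall>n \<in> set ns. n = 1 then q else 8)"
  by (induction ns) (auto simp: unit_step_nat_code[OF q] unit_step_sink)

lemma unit_step_instance:
  "foldl unit_step 0 (map letter_symbol (serialize (instance_code x))) = 7 \<longleftrightarrow> unweighted x"
proof -
  obtain r where r: "serialize (instance_code x) =
    Open # Open # concat (map (serialize \<circ> nat_code) (coalition_weights x)) @ Close #
    Open # concat (map (serialize \<circ> nat_code) (other_weights x)) @ Close # r"
    using serialize_instance[of x] by metis
  let ?c = "\<forall>n \<in> set (coalition_weights x). n = 1" and ?o = "\<forall>n \<in> set (other_weights x). n = 1"
  let ?f = "\<lambda>q w. foldl unit_step q (map letter_symbol w)"
  let ?w = "concat (map (serialize \<circ> nat_code) (other_weights x))"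
  have sink: "?f 8 w = 8" "?f 7 w = 7" for w by (simp_all add: unit_step_sink)
  have "?f 0 (serialize (instance_code x)) =
      ?f (if ?c then 2 else 8) (Close # Open # ?w @ Close # r)"
    unfolding r using unit_step_nat_codes[of 2 "coalition_weights x"]
    by (simp add: unit_step_def[of 0] unit_step_def[of 1] unit_step_def[of "Suc 0"] del: map_concat)
  also have "\<dots> = (if ?c then ?f 5 (?w @ Close # r) else 8)"
    using sink(1)[of "Close # Open # ?w @ Close # r"]
    by (simp add: unit_step_def[of 2] unit_step_def[of 4])
  also have "?f 5 (?w @ Close # r) = ?f (if ?o then 5 else 8) (Close # r)"
    using unit_step_nat_codes[of 5 "other_weights x"] by simp
  also have "\<dots> = (if ?o then 7 else 8)"
    using sink(1)[of "Close # r"] sink(2)[of r] by (simp add: unit_step_def[of 5])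
  finally show ?thesis by (auto simp: unweighted_def)
qed

section \<open>Anonymity\<close>

lemma set_unweight: "set (unweight ws V) \<subseteq> set V"
  unfolding unweight_def by (auto dest: set_zip_rightD)

text \<open>For several unequal weights this can fail, because permuting \<open>C\<close> hands
  votes to other weights. Here the restriction of the instances enters the anonymity
  argument.\<close>

lemma mset_unweight_cong:
  assumes "single_manipulator x \<or> unweighted x"
    and "length C = length (coalition_weights x)" "mset C' = mset C"
  shows "mset (unweight (coalition_weights x) C') = mset (unweight (coalition_weights x) C)"
  using assms(1)
proof
  assume "single_manipulator x"
  then have "length C = 1" using assms(2) by (simp add: single_manipulator_def)
  then have "C' = C"
    using assms(3) by (cases C) (auto simp: length_Suc_conv)
  then show ?thesis by simp
next
  assume "unweighted x"
  then have "coalition_weights x = replicate (length C) 1"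
    using assms(2) by (intro replicate_eqI) (auto simp: unweighted_def)
  moreover have "unweight (replicate (length D) 1) D = D" for D
    by (induction D) (auto simp: unweight_def)
  moreover have "length C' = length C" using assms(3) by (rule mset_eq_length)
  ultimately show ?thesis using assms(3) by metis
qed

lemma winner_cong:
  assumes "anonymous_protocol m f" "set V \<subseteq> votes m" "set C \<subseteq> votes m"
    and "single_manipulator x \<or> unweighted x"
    and "length C = length (coalition_weights x)" "mset C' = mset C"
  shows "winner f x V C' = winner f x V C"
proof -
  let ?U = "\<lambda>C. unweight (other_weights x) V @ unweight (coalition_weights x) C"
  have "mset (?U C') = mset (?U C)" using mset_unweight_cong[OF assms(4-6)] by simp
  moreover have "set (?U C) \<subseteq> votes m"
    using set_unweight[of _ V] set_unweight[of _ C] assms(2,3) by fastforce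
  ultimately show ?thesis using assms(1) unfolding winner_def anonymous_protocol_def by blast
qed

lemma achieves_cong:
  assumes "anonymous_setting m S" "valid_instance m S x" "set C \<subseteq> votes m"
    and "single_manipulator x \<or> unweighted x"
    and "length C = length (coalition_weights x)" "mset C' = mset C"
  shows "achieves S g x C' = achieves S g x C"
proof -
  note cong = winner_cong[OF _ _ assms(3-6)]
  have valid: "valid_info m (length (other_weights x)) S (info x)"
    using assms(2) by (simp add: valid_instance_def)
  show ?thesis
  proof (cases S)
    case (Certain f)
    with valid obtain V where V: "info x = Votes_Info V" "set V \<subseteq> votes m"
      by (cases "info x") (auto simp: profiles_def)
    then show ?thesis using Certain assms(1) cong[of f V] by (simp add: achieves_def)
  next
    case (Uncertain_Protocol F D)
    with valid obtain V d r where V: "info x = Protocol_Dist_Info V d r" "set V \<subseteq> votes m"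
      by (cases "info x") (auto simp: profiles_def)
    then show ?thesis
      using Uncertain_Protocol assms(1) cong[of _ V] by (simp add: achieves_def)
  next
    case (Uncertain_Votes f D)
    with valid obtain d r \<mu> where V: "info x = Votes_Dist_Info d r" "D d = Some \<mu>"
      "set_pmf \<mu> \<subseteq> profiles m (length (other_weights x))"
      by (cases "info x") auto
    let ?A = "\<lambda>C. {V. goal_met g (target x) (winner f x V C)}"
    \<comment> \<open>Anonymity speaks only of genuine votes, which is guaranteed for the profiles
      in the support. So the two events are compared only there, which suffices for their
      probabilities.\<close>
    have "winner f x V C' = winner f x V C" if "V \<in> set_pmf \<mu>" for V
      using that V(3) Uncertain_Votes assms(1) by (intro cong) (auto simp: profiles_def)
    then have "?A C' \<inter> set_pmf \<mu> = ?A C \<inter> set_pmf \<mu>" by auto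
    then have "measure_pmf.prob \<mu> (?A C') = measure_pmf.prob \<mu> (?A C)"
      by (metis measure_Int_set_pmf)
    then show ?thesis using Uncertain_Votes V by (simp add: achieves_def)
  qed
qed

text \<open>Provides the rearrangement of \<open>C\<close> in the order of \<open>vs\<close>, the
  form in which the nested loops generate votes.\<close>

lemma mset_by_multiplicities:
  assumes "distinct vs" "set C \<subseteq> set vs"
  shows "mset (concat (map (\<lambda>v. replicate (count (mset C) v) v) vs)) = mset C"
proof (rule multiset_eqI)
  fix a
  have "count (mset (concat (map (\<lambda>v. replicate (n v) v) vs))) a = (if a \<in> set vs then n a else 0)" for n
    using assms(1) by (induction vs) auto
  moreover have "count (mset C) a = 0" if "a \<notin> set vs"
    using that assms(2) by (auto simp: not_in_iff[symmetric])
  ultimately show "count (mset (concat (map (\<lambda>v. replicate (count (mset C) v) v) vs))) a =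
      count (mset C) a"
    by simp
qed

section \<open>Reduction to exhaustive search\<close>

text \<open>Used for soundness: the multiplicities can be forgotten, as it is enough that the tested
  word ends in some list of votes.\<close>

lemma reachable_imp_word:
  "reachable P n u (map f vs) \<Longrightarrow> \<exists>C. set C \<subseteq> set vs \<and> P (u @ concat (map f C))"
proof (induction vs arbitrary: u)
  case Nil
  then show ?case by (intro exI[of _ "[]"]) simp
next
  case (Cons v vs)
  from Cons.prems obtain i where "reachable P n (u @ concat (replicate i (f v))) (map f vs)"
    by auto
  from Cons.IH[OF this] obtain C where
    "set C \<subseteq> set vs" "P ((u @ concat (replicate i (f v))) @ concat (map f C))"
    by blast
  then show ?case by (intro exI[of _ "replicate i v @ C"]) auto
qed

lemma reachable_multiplicities:
  assumes "\<forall>v \<in> set vs. n v < b"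
    and "P (u @ concat (map f (concat (map (\<lambda>v. replicate (n v) v) vs))))"
  shows "reachable P b u (map f vs)"
  using assms by (induction vs arbitrary: u) auto

definition vote_word :: "vote \<Rightarrow> letter list" where
  "vote_word v = serialize (Group (map nat_code v))"

lemma wrapped_votes:
  "wrapped ((w @ [Open]) @ concat (map vote_word C)) = Open # (w @ serialize (votes_code C)) @ [Close]"
  by (simp add: wrapped_def votes_code_def vote_word_def[abs_def] comp_def)

lemma serialize_evaluation:
  "serialize (Group [c, votes_code C]) = Open # (serialize c @ serialize (votes_code C)) @ [Close]"
  by simp

text \<open>\<open>A\<close> is tied to \<open>R\<close> only on codes of instances. On other words
  it may take any value, because a successful test already forces the word to be such a
  code.\<close>

lemma manipulation_problem_reachable:
  assumes anon: "anonymous_setting m S"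
    and vs: "set vs = votes m" "distinct vs"
    and R: "\<And>x. R x \<Longrightarrow> single_manipulator x \<or> unweighted x"
    and A: "\<And>x. A (serialize (instance_code x)) \<longleftrightarrow> R x"
  shows "manipulation_problem m S g R =
    {w. A w \<and> reachable (\<lambda>u. wrapped u \<in> evaluation_problem m S g) (length w) (w @ [Open])
      (map vote_word vs)}" (is "_ = ?rhs")
proof (intro set_eqI iffI)
  fix w
  assume "w \<in> manipulation_problem m S g R"
  then obtain x C where x: "w = serialize (instance_code x)" "valid_instance m S x" "R x"
    and C: "C \<in> coalition_profiles m x" "achieves S g x C"
    unfolding manipulation_problem_def by blast
  have len: "length C = length (coalition_weights x)" and setC: "set C \<subseteq> votes m"
    using C(1) by (auto simp: coalition_profiles_def profiles_def)
  let ?n = "count (mset C)"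
  define C' where "C' = concat (map (\<lambda>v. replicate (?n v) v) vs)"
  have ms: "mset C' = mset C"
    unfolding C'_def by (rule mset_by_multiplicities) (use vs setC in auto)
  then have "C' \<in> coalition_profiles m x"
    using C(1) mset_eq_length[OF ms] mset_eq_setD[OF ms]
    by (simp add: coalition_profiles_def profiles_def)
  moreover have "achieves S g x C'"
    using achieves_cong[OF anon x(2) setC R[OF x(3)] len ms] C(2) by simp
  ultimately have "wrapped ((w @ [Open]) @ concat (map vote_word C')) \<in> evaluation_problem m S g"
    unfolding wrapped_votes evaluation_problem_def serialize_evaluation x(1) using x(2) by blast
  moreover have "?n v < length w" for v
  proof -
    have "?n v \<le> length C" using count_le_size[of "mset C" v] by simp
    then show ?thesis using length_serialize_instance[of x] len x(1) by simp
  qed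
  ultimately have "reachable (\<lambda>u. wrapped u \<in> evaluation_problem m S g) (length w) (w @ [Open])
      (map vote_word vs)"
    unfolding C'_def by (intro reachable_multiplicities ballI)
  then show "w \<in> ?rhs" using A[of x] x by simp
next
  fix w
  assume w: "w \<in> ?rhs"
  then obtain C where "wrapped ((w @ [Open]) @ concat (map vote_word C)) \<in> evaluation_problem m S g"
    by (auto dest: reachable_imp_word)
  then obtain x C' where x: "valid_instance m S x" "C' \<in> coalition_profiles m x" "achieves S g x C'"
    and eq: "w @ serialize (votes_code C) = serialize (instance_code x) @ serialize (votes_code C')"
    unfolding wrapped_votes evaluation_problem_def serialize_evaluation by auto
  \<comment> \<open>Vote lists are encoded as groups, so the last group splits off on both sides,
    although nothing is known yet about how \<open>C\<close> and \<open>C'\<close> are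
    related.\<close>
  have "w = serialize (instance_code x)"
    using eq unfolding votes_code_def by (rule serialize_Group_suffix_unique)
  moreover have "R x" using w A[of x] calculation by simp
  ultimately show "w \<in> manipulation_problem m S g R"
    using x unfolding manipulation_problem_def by blast
qed

lemma manipulation_problem_PTIME:
  fixes \<delta> :: "nat \<Rightarrow> nat \<Rightarrow> nat"
  assumes "anonymous_setting m S" "evaluation_problem m S g \<in> PTIME"
    and "\<And>x. R x \<Longrightarrow> single_manipulator x \<or> unweighted x"
    and "\<And>x. foldl \<delta> 0 (map letter_symbol (serialize (instance_code x))) = q \<longleftrightarrow> R x"
    and "\<And>q s. \<delta> q s \<le> b"
  shows "manipulation_problem m S g R \<in> PTIME"
proof -
  \<comment> \<open>The list depends on \<open>m\<close> alone and not on the input, so one machine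
    with a fixed number of loops serves all inputs.\<close>
  obtain vs where vs: "set vs = votes m" "distinct vs"
    using finite_distinct_list[of "votes m"] by (auto simp: votes_def)
  have "manipulation_problem m S g R =
      {w. foldl \<delta> 0 (map letter_symbol w) = q \<and>
        reachable (\<lambda>u. wrapped u \<in> evaluation_problem m S g) (length w) (w @ [Open])
          (map vote_word vs)}"
    by (rule manipulation_problem_reachable[OF assms(1) vs]) (fact assms)+
  then show ?thesis using PTIME_reachable[OF assms(2,5), where F = "\<lambda>p. p = q"] by simp
qed

theorem proposition1:
  fixes m :: nat and S :: "'i setting" and g :: goal
  assumes "anonymous_setting m S"
    and "evaluation_problem m S g \<in> PTIME"
  shows "manipulation_problem m S g single_manipulator \<in> PTIME
    \<and> manipulation_problem m S g unweighted \<in> PTIME"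
proof
  show "manipulation_problem m S g single_manipulator \<in> PTIME"
    \<comment> \<open>\<open>q\<close> is the accepting state, and \<open>b\<close> is the largest
      state number, that of the rejecting sink.\<close>
    by (rule manipulation_problem_PTIME[OF assms, where \<delta> = single_step and q = 4 and b = 5])
      (auto simp: single_step_instance, simp add: single_step_def)
  show "manipulation_problem m S g unweighted \<in> PTIME"
    by (rule manipulation_problem_PTIME[OF assms, where \<delta> = unit_step and q = 7 and b = 8])
      (auto simp: unit_step_instance, simp add: unit_step_def)
qed

end
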